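(* Let $k\ge2$ be an integer. Then $$\limsup_{n\to\infty}\frac{\log \tau^{(e)}_k(n)\,\log\log n}{\log n}=\frac{\log k}{2},\qquad \limsup_{n\to\infty}\frac{\log \tau^{(e)}_{k*}(n)\,\log\log n}{\log n}=\frac12\log\binom{k+1}{2},$$ $$\limsup_{N(\alpha)\to\infty}\frac{\log {\mathfrak t}^{(e)}_k(\alpha)\,\log\log N(\alpha)}{\log N(\alpha)}=\frac{\log k}{2},\qquad \limsup_{N(\alpha)\to\infty}\frac{\log {\mathfrak t}^{(e)}_{k*}(\alpha)\,\log\log N(\alpha)}{\log N(\alpha)}=\frac12\log\binom{k+1}{2}.$$
   Context: $\mathbb{Z}[i]$ is the ring of Gaussian integers, $N(a+bi)=a^2+b^2$. For a positive integer $a$, $\tau_k(a)$ is the number of ordered $k$-tuples of positive integers $(d_1,\dots,d_k)$ with $d_1\cdots d_k=a$, and ${\mathfrak t}_k(a)$ is the number of ordered $k$-tuples $({\mathfrak d}_1,\dots,{\mathfrak d}_k)$ of nonzero Gaussian integers, each taken up to associates (i.e. up to multiplication by $\pm1,\pm i$), such that ${\mathfrak d}_1\cdots{\mathfrak d}_k$ is associated to $a$ (equivalently, the number of ordered $k$-tuples of ideals of $\mathbb{Z}[i]$ whose product is $a\mathbb{Z}[i]$). The functions $\tau^{(e)}_k,\tau^{(e)}_{k*}$ are multiplicative functions on positive integers with $\tau^{(e)}_k(p^a)=\tau_k(a)$ and $\tau^{(e)}_{k*}(p^a)={\mathfrak t}_k(a)$ for every rational prime $p$ and $a\ge1$. The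 functions ${\mathfrak t}^{(e)}_k,{\mathfrak t}^{(e)}_{k*}$ are multiplicative functions on nonzero Gaussian integers, defined by ${\mathfrak t}^{(e)}_k(\varepsilon{\mathfrak p}_1^{a_1}\cdots{\mathfrak p}_r^{a_r})=\prod_j\tau_k(a_j)$ and ${\mathfrak t}^{(e)}_{k*}(\varepsilon{\mathfrak p}_1^{a_1}\cdots{\mathfrak p}_r^{a_r})=\prod_j{\mathfrak t}_k(a_j)$ for a unit $\varepsilon$ and pairwise non-associated Gaussian primes ${\mathfrak p}_j$. *)

theory Defs
  imports "HOL-Analysis.Analysis" "HOL-Computational_Algebra.Primes"
begin

definition tau :: "nat \<Rightarrow> nat \<Rightarrow> nat" where
  "tau k a = card {ds :: nat list. length ds = k \<and> (\<forall>d\<in>set ds. d > 0) \<and> prod_list ds = a}"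

definition GI :: "complex set" where
  "GI = {z. Re z \<in> \<int> \<and> Im z \<in> \<int>}"

definition gauss :: "int \<times> int \<Rightarrow> complex" where
  "gauss ab = Complex (of_int (fst ab)) (of_int (snd ab))"

definition gnorm :: "int \<times> int \<Rightarrow> int" where
  "gnorm ab = (fst ab)^2 + (snd ab)^2"

definition gdvd :: "complex \<Rightarrow> complex \<Rightarrow> bool" where
  "gdvd x y \<longleftrightarrow> (\<exists>c\<in>GI. y = x * c)"

definition gunits :: "complex set" where
  "gunits = {1, -1, \<i>, -\<i>}"

definition gassoc :: "complex \<Rightarrow> complex \<Rightarrow> bool" where
  "gassoc x y \<longleftrightarrow> (\<exists>u\<in>gunits. x = u * y)"

text \<open>Canonical representative of an associate class of nonzero Gaussian integers.\<close>
definition gnormalized :: "complex \<Rightarrow> bool" where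
  "gnormalized z \<longleftrightarrow> z \<in> GI \<and> Re z > 0 \<and> Im z \<ge> 0"

definition gprime :: "complex \<Rightarrow> bool" where
  "gprime p \<longleftrightarrow> p \<in> GI \<and> p \<noteq> 0 \<and> p \<notin> gunits \<and>
     (\<forall>x\<in>GI. \<forall>y\<in>GI. gdvd p (x * y) \<longrightarrow> gdvd p x \<or> gdvd p y)"

definition gmult :: "complex \<Rightarrow> complex \<Rightarrow> nat" where
  "gmult p a = (GREATEST e. gdvd (p ^ e) a)"

text \<open>frak t k a: number of ordered k-tuples of nonzero Gaussian integers up to
  associates (represented by normalized ones) whose product is associated to a.\<close>
definition ttau :: "nat \<Rightarrow> nat \<Rightarrow> nat" where
  "ttau k a = card {ds :: complex list. length ds = k \<and> (\<forall>d\<in>set ds. gnormalized d)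
                    \<and> gassoc (prod_list ds) (of_nat a)}"

definition tauE :: "nat \<Rightarrow> nat \<Rightarrow> nat" where
  "tauE k n = (\<Prod>p\<in>prime_factors n. tau k (multiplicity p n))"

definition tauEs :: "nat \<Rightarrow> nat \<Rightarrow> nat" where
  "tauEs k n = (\<Prod>p\<in>prime_factors n. ttau k (multiplicity p n))"

definition gtauE :: "nat \<Rightarrow> complex \<Rightarrow> nat" where
  "gtauE k a = (\<Prod>p\<in>{p. gprime p \<and> gnormalized p \<and> gdvd p a}. tau k (gmult p a))"

definition gtauEs :: "nat \<Rightarrow> complex \<Rightarrow> nat" where
  "gtauEs k a = (\<Prod>p\<in>{p. gprime p \<and> gnormalized p \<and> gdvd p a}. ttau k (gmult p a))"

end

theory Submission
  imports Defs "HOL-Library.Discrete_Functions" "HOL-Real_Asymp.Real_Asymp"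
begin

text \<open>
  Let \<open>f\<close> be a multiplicative function whose value at \<open>p ^ m\<close> is \<open>F m\<close>, where \<open>F 2 = M\<close>,
  \<open>F m \<le> M ^ (m / 2)\<close> and \<open>F\<close> grows polynomially. In a factorial ring with a multiplicative norm \<open>N\<close>
  such that the number of classes of elements of norm at most \<open>n\<close> has order \<open>n\<close>, the maximal order of
  \<open>ln f(x)\<close> is \<open>(ln M / 2) ln N(x) / ln (ln N(x))\<close>. For the upper bound with \<open>L = ln N(x)\<close>, the primes of norm
  at most \<open>L powr (1 - d)\<close> contribute \<open>o(L / ln L)\<close> because \<open>F\<close> is polynomially bounded, and the exponents of
  the other primes add up to at most \<open>L / ((1 - d) ln L)\<close>. For the lower bound take the square of the
  product of all primes of norm at most \<open>n\<close>; this only needs more than \<open>n powr (1 - e)\<close> such primes for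
  infinitely many \<open>n\<close>, which Erdos's argument for the divergence of the sum of the reciprocals of the
  primes provides.

  The number of factorizations into \<open>k\<close> factors is submultiplicative, which reduces \<open>F m \<le> M ^ (m / 2)\<close>
  to its values at rational primes. For the Gaussian integers \<open>2\<close> is associated to \<open>(1 + \<i>)\<^sup>2\<close>, whence
  \<open>M = (k + 1) choose 2\<close>; every odd rational prime has at most two Gaussian prime factors, hence at most
  \<open>k\<^sup>2\<close> factorizations, and \<open>k ^ 3 \<le> M\<^sup>2\<close>.
\<close>

section \<open>Factorial rings with a norm\<close>

text \<open>What \<open>nat\<close> and the Gaussian integers have in common, so that one argument
  serves both; a semiring as base class admits \<open>nat\<close>. The upper count feeds the sieve
  and the bound on the number of small primes, the lower count supplies the elements that the sieve
  has to exhaust. No count of primes is assumed.\<close>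

locale normed_ufd =
  fixes N :: "'a::factorial_semiring_gcd \<Rightarrow> nat" and C :: nat
  assumes N_mult: "N (x * y) = N x * N y"
    and N_eq_0_iff [simp]: "N x = 0 \<longleftrightarrow> x = 0"
    and N_eq_1_iff: "N x = 1 \<longleftrightarrow> is_unit x"
    and finite_bounded: "finite {x. normalize x = x \<and> x \<noteq> 0 \<and> N x \<le> n}"
    and card_bounded_le: "card {x. normalize x = x \<and> x \<noteq> 0 \<and> N x \<le> n} \<le> C * n"
    and card_bounded_ge: "n \<le> C * card {x. normalize x = x \<and> x \<noteq> 0 \<and> N x \<le> n}"
begin

section \<open>Elements of bounded norm and the norm of a factorization\<close>

definition bounded_elems :: "nat \<Rightarrow> 'a set" where
  "bounded_elems n = {x. normalize x = x \<and> x \<noteq> 0 \<and> N x \<le> n}"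

definition bounded_primes :: "nat \<Rightarrow> 'a set" where
  "bounded_primes n = {p. prime p \<and> N p \<le> n}"

definition mult_fun :: "(nat \<Rightarrow> nat) \<Rightarrow> 'a \<Rightarrow> nat" where
  "mult_fun F x = (\<Prod>p\<in>prime_factors x. F (multiplicity p x))"

lemma finite_bounded_elems [simp]: "finite (bounded_elems n)"
  using finite_bounded by (simp add: bounded_elems_def)

lemma card_bounded_elems_le: "card (bounded_elems n) \<le> C * n"
  using card_bounded_le by (simp add: bounded_elems_def)

lemma card_bounded_elems_ge: "n \<le> C * card (bounded_elems n)"
  using card_bounded_ge by (simp add: bounded_elems_def)

lemma C_pos: "C > 0"
  using card_bounded_elems_ge[of 1] by (cases C) auto

lemma bounded_primes_subset: "bounded_primes n \<subseteq> bounded_elems n"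
  by (auto simp: bounded_primes_def bounded_elems_def)

lemma finite_bounded_primes [simp]: "finite (bounded_primes n)"
  using bounded_primes_subset finite_bounded_elems finite_subset by blast

lemma N_unit: "is_unit u \<Longrightarrow> N u = 1"
  using N_eq_1_iff by blast

lemma N_ge_1 [simp]: "x \<noteq> 0 \<Longrightarrow> Suc 0 \<le> N x"
  using N_eq_0_iff[of x] by linarith

lemma N_one [simp]: "N 1 = 1"
  by (simp add: N_unit)

lemma N_normalize [simp]: "N (normalize x) = N x"
proof (cases "x = 0")
  case False
  have "N x = N (unit_factor x * normalize x)" by simp
  also have "\<dots> = N (normalize x)"
    using False N_unit[of "unit_factor x"] by (simp add: N_mult del: unit_factor_mult_normalize)
  finally show ?thesis by simp
qed simp

lemma N_cong: "normalize x = normalize y \<Longrightarrow> N x = N y"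
  by (metis N_normalize)

lemma N_power: "N (x ^ n) = N x ^ n"
  by (induction n) (auto simp: N_mult)

lemma N_prod: "N (prod f S) = (\<Prod>x\<in>S. N (f x))"
  by (induction S rule: infinite_finite_induct) (auto simp: N_mult)

lemma N_prime_ge_2: "prime p \<Longrightarrow> N p \<ge> 2"
  using N_eq_0_iff[of p] N_eq_1_iff[of p] not_prime_unit[of p] by fastforce

lemma dvd_imp_N_le: "x dvd y \<Longrightarrow> y \<noteq> 0 \<Longrightarrow> N x \<le> N y"
  by (auto simp: N_mult elim!: dvdE)

lemma N_factorization:
  assumes "x \<noteq> 0"
  shows "N x = (\<Prod>p\<in>prime_factors x. N p ^ multiplicity p x)"
proof -
  have "N x = N (prod_mset (prime_factorization x))"
    by (intro N_cong prod_mset_prime_factorization_weak[symmetric] assms)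
  also have "\<dots> = (\<Prod>p\<in>prime_factors x. N p ^ multiplicity p x)"
    unfolding prod_mset_multiplicity N_prod N_power
    by (intro prod.cong refl) (auto simp: count_prime_factorization)
  finally show ?thesis .
qed

lemma ln_N_factorization:
  assumes "x \<noteq> 0"
  shows "ln (real (N x)) = (\<Sum>p\<in>prime_factors x. real (multiplicity p x) * ln (real (N p)))"
proof -
  have pos: "N p > 0" if "p \<in> prime_factors x" for p
    using N_prime_ge_2[of p] that by (auto simp: in_prime_factors_iff)
  have "ln (real (N x)) = ln (\<Prod>p\<in>prime_factors x. real (N p) ^ multiplicity p x)"
    by (subst N_factorization[OF assms]) simp
  also have "\<dots> = (\<Sum>p\<in>prime_factors x. ln (real (N p) ^ multiplicity p x))"
    by (rule ln_prod) (use pos in auto)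
  also have "\<dots> = (\<Sum>p\<in>prime_factors x. real (multiplicity p x) * ln (real (N p)))"
    by (intro sum.cong refl) (use pos in \<open>auto simp: ln_realpow\<close>)
  finally show ?thesis .
qed

subsection \<open>Many primes of small norm\<close>

text \<open>Induction on the prime factors: multiplying by \<open>p\<close> inserts \<open>p\<close>
  into \<open>T\<close> or, if \<open>p\<close> is already there, takes it out of \<open>T\<close>
  and moves it into \<open>b\<close>. Equality holds only up to units, hence
  \<open>normalize\<close> on both sides.\<close>

lemma square_times_primes_decomp:
  assumes "x \<noteq> 0"
  shows "\<exists>b T. T \<subseteq> prime_factors x \<and> normalize b = b \<and> b \<noteq> 0 \<and> normalize x = normalize (b\<^sup>2 * \<Prod>T)"
  using assms
proof (induction x rule: prime_divisors_induct)
  case (unit x)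
  then show ?case
    by (intro exI[of _ 1] exI[of _ "{}"]) (auto simp: is_unit_normalize)
next
  case (factor p x)
  then have x: "x \<noteq> 0" "p \<noteq> 0" and p: "prime p" by auto
  have pf: "prime_factors (p * x) = insert p (prime_factors x)"
    using prime_factorization_mult[of p x] x p by (auto simp: prime_factorization_prime)
  obtain b T where T: "T \<subseteq> prime_factors x" "normalize b = b" "b \<noteq> 0"
    "normalize x = normalize (b\<^sup>2 * \<Prod>T)"
    using factor x by auto
  have finT: "finite T" using T(1) finite_subset by blast
  have px: "normalize (p * x) = normalize (p * (b\<^sup>2 * \<Prod>T))"
    using T(4) by (metis normalize_mult_normalize_right)
  show ?case
  proof (cases "p \<in> T")
    case True
    have "p * (b\<^sup>2 * \<Prod>T) = (b * p) ^ 2 * \<Prod>(T - {p})"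
      using True finT by (subst prod.remove[of T p]) (auto simp: power2_eq_square mult_ac)
    then have "normalize (p * x) = normalize (normalize (b * p) ^ 2 * \<Prod>(T - {p}))"
      using px by (metis normalize_mult_normalize_left normalize_power_normalize)
    then show ?thesis using T x pf
      by (intro exI[of _ "normalize (b * p)"] exI[of _ "T - {p}"]) auto
  next
    case False
    have "p * (b\<^sup>2 * \<Prod>T) = b ^ 2 * \<Prod>(insert p T)"
      using False finT by (simp add: mult_ac)
    then show ?thesis using T x pf px
      by (intro exI[of _ b] exI[of _ "insert p T"]) auto
  qed
qed simp

text \<open>\<open>x\<close> is determined by \<open>b\<close>, for which
  \<open>N b \<le> m\<close>, and by \<open>T \<subseteq> S\<close>; this leaves at most
  \<open>C * m\<close> and \<open>2 ^ card S\<close> choices.\<close>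

lemma card_smooth_le:
  "card {x \<in> bounded_elems (m\<^sup>2). prime_factors x \<subseteq> S} \<le> 2 ^ card S * (C * m)" if "finite S"
proof -
  have "{x \<in> bounded_elems (m\<^sup>2). prime_factors x \<subseteq> S}
     \<subseteq> (\<lambda>(b, T). normalize (b\<^sup>2 * \<Prod>T)) ` (bounded_elems m \<times> Pow S)"
  proof
    fix x assume x: "x \<in> {x \<in> bounded_elems (m\<^sup>2). prime_factors x \<subseteq> S}"
    then have "x \<noteq> 0" "normalize x = x" "N x \<le> m\<^sup>2" by (auto simp: bounded_elems_def)
    then obtain b T where bT: "T \<subseteq> prime_factors x" "normalize b = b" "b \<noteq> 0"
      "x = normalize (b\<^sup>2 * \<Prod>T)"
      using square_times_primes_decomp by metis
    have "N b ^ 2 \<le> N x"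
    proof -
      have "N x = N b ^ 2 * N (\<Prod>T)" using bT(4) by (simp add: N_mult N_power)
      moreover have "N (\<Prod>T) \<ge> 1" using \<open>x \<noteq> 0\<close> bT(4) by auto
      ultimately show ?thesis by simp
    qed
    with \<open>N x \<le> m\<^sup>2\<close> have "N b \<le> m" by (meson le_trans power2_nat_le_eq_le)
    then show "x \<in> (\<lambda>(b, T). normalize (b\<^sup>2 * \<Prod>T)) ` (bounded_elems m \<times> Pow S)"
      using x bT by (intro image_eqI[of _ _ "(b, T)"]) (auto simp: bounded_elems_def)
  qed
  then have "card {x \<in> bounded_elems (m\<^sup>2). prime_factors x \<subseteq> S} \<le> card (bounded_elems m \<times> Pow S)"
    using that by (intro surj_card_le) auto
  also have "\<dots> = card (bounded_elems m) * 2 ^ card S"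
    using that by (simp add: card_cartesian_product card_Pow)
  also have "\<dots> \<le> 2 ^ card S * (C * m)"
    using card_bounded_elems_le[of m] by (simp add: mult.commute)
  finally show ?thesis .
qed

lemma card_multiples_le:
  assumes "prime p"
  shows "card {x \<in> bounded_elems n. p dvd x} \<le> C * (n div N p)"
proof -
  have "{x \<in> bounded_elems n. p dvd x} \<subseteq> (\<lambda>z. normalize (p * z)) ` bounded_elems (n div N p)"
  proof
    fix x assume "x \<in> {x \<in> bounded_elems n. p dvd x}"
    then have x: "normalize x = x" "x \<noteq> 0" "N x \<le> n" "p dvd x" by (auto simp: bounded_elems_def)
    then obtain z where z: "x = p * z" by auto
    have "N z \<le> n div N p"
      using x z N_prime_ge_2[OF assms] by (simp add: N_mult less_eq_div_iff_mult_less_eq mult.commute)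
    then show "x \<in> (\<lambda>z. normalize (p * z)) ` bounded_elems (n div N p)"
      using x z by (intro image_eqI[of _ _ "normalize z"]) (auto simp: bounded_elems_def)
  qed
  then have "card {x \<in> bounded_elems n. p dvd x} \<le> card (bounded_elems (n div N p))"
    by (intro surj_card_le) auto
  also have "\<dots> \<le> C * (n div N p)" by (rule card_bounded_elems_le)
  finally show ?thesis .
qed

text \<open>An element of norm at most \<open>m^2\<close> either has only prime factors of norm at
  most \<open>y\<close> or is a multiple of a prime of larger norm. One factor \<open>C\<close>
  comes from counting these two kinds, the other from the lower bound for the number of all
  elements.\<close>

lemma Erdos_sieve_bound:
  "real (m\<^sup>2) \<le> C\<^sup>2 * (2 ^ card (bounded_primes y) * m
      + (\<Sum>p\<in>bounded_primes (m\<^sup>2) - bounded_primes y. real (m\<^sup>2) / N p))"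
proof -
  let ?n = "m\<^sup>2" and ?S = "bounded_primes y" and ?R = "bounded_primes (m\<^sup>2) - bounded_primes y"
  let ?smooth = "{x \<in> bounded_elems ?n. prime_factors x \<subseteq> ?S}"
  have "bounded_elems ?n \<subseteq> ?smooth \<union> (\<Union>p\<in>?R. {x \<in> bounded_elems ?n. p dvd x})"
  proof
    fix x assume x: "x \<in> bounded_elems ?n"
    show "x \<in> ?smooth \<union> (\<Union>p\<in>?R. {x \<in> bounded_elems ?n. p dvd x})"
    proof (cases "prime_factors x \<subseteq> ?S")
      case False
      then obtain p where p: "prime p" "p dvd x" "p \<notin> ?S"
        by (auto simp: in_prime_factors_iff)
      moreover have "N p \<le> ?n"
        using dvd_imp_N_le[of p x] p x by (auto simp: bounded_elems_def)
      ultimately show ?thesis using x by (auto simp: bounded_primes_def)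
    qed (use x in auto)
  qed
  then have "card (bounded_elems ?n) \<le> card (?smooth \<union> (\<Union>p\<in>?R. {x \<in> bounded_elems ?n. p dvd x}))"
    by (intro card_mono) auto
  also have "\<dots> \<le> card ?smooth + card (\<Union>p\<in>?R. {x \<in> bounded_elems ?n. p dvd x})"
    by (rule card_Un_le)
  also have "\<dots> \<le> 2 ^ card ?S * (C * m) + (\<Sum>p\<in>?R. C * (?n div N p))"
  proof (rule add_mono)
    show "card ?smooth \<le> 2 ^ card ?S * (C * m)" by (rule card_smooth_le) simp
    have "card (\<Union>p\<in>?R. {x \<in> bounded_elems ?n. p dvd x})
            \<le> (\<Sum>p\<in>?R. card {x \<in> bounded_elems ?n. p dvd x})"
      by (rule card_UN_le) simp
    also have "\<dots> \<le> (\<Sum>p\<in>?R. C * (?n div N p))"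
      by (intro sum_mono card_multiples_le) (auto simp: bounded_primes_def)
    finally show "card (\<Union>p\<in>?R. {x \<in> bounded_elems ?n. p dvd x}) \<le> \<dots>" .
  qed
  finally have "real (card (bounded_elems ?n))
      \<le> real (2 ^ card ?S * (C * m) + (\<Sum>p\<in>?R. C * (?n div N p)))"
    by (rule of_nat_mono)
  also have "\<dots> = C * (2 ^ card ?S * m + (\<Sum>p\<in>?R. real (?n div N p)))"
    by (simp add: sum_distrib_left algebra_simps)
  also have "\<dots> \<le> C * (2 ^ card ?S * m + (\<Sum>p\<in>?R. real ?n / N p))"
    by (intro mult_left_mono add_left_mono sum_mono of_nat_div_le_of_nat) auto
  finally have "real (card (bounded_elems ?n)) \<le> C * (2 ^ card ?S * m + (\<Sum>p\<in>?R. real ?n / N p))" .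
  then have "C * real (card (bounded_elems ?n))
      \<le> C * (C * (2 ^ card ?S * m + (\<Sum>p\<in>?R. real ?n / N p)))"
    by (intro mult_left_mono) auto
  moreover have "real ?n \<le> C * real (card (bounded_elems ?n))"
    using of_nat_mono[OF card_bounded_elems_ge[of ?n], where 'a = real] by simp
  ultimately show ?thesis by (simp add: power2_eq_square mult.assoc)
qed

text \<open>The primes with norm above \<open>2 ^ K\<close> and at most \<open>2 ^ (K + 1)\<close>
  contribute at most \<open>2 * r ^ (K + 1)\<close>. The bound is a multiple of
  \<open>r ^ J - r ^ K\<close> because then the induction telescopes.\<close>

lemma sum_inverse_primes_le:
  assumes r: "0 < r" "r < 1" and K: "J \<le> K"
    and bound: "\<And>j. j > J \<Longrightarrow> real (card (bounded_primes (2 ^ j))) \<le> 2 ^ j * r ^ j"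
  shows "(\<Sum>p\<in>bounded_primes (2 ^ K) - bounded_primes (2 ^ J). 1 / real (N p))
           \<le> 2 / (1 - r) * (r ^ J - r ^ K)"
  using K
proof (induction K rule: dec_induct)
  case (step K)
  let ?P = bounded_primes
  have sub: "?P (2 ^ J) \<subseteq> ?P (2 ^ K)"
    using step.hyps by (auto simp: bounded_primes_def intro: order.trans power_increasing)
  have "?P (2 ^ K) \<subseteq> ?P (2 ^ Suc K)"
    by (auto simp: bounded_primes_def)
  with sub have "?P (2 ^ Suc K) - ?P (2 ^ J)
      = (?P (2 ^ K) - ?P (2 ^ J)) \<union> (?P (2 ^ Suc K) - ?P (2 ^ K))" by auto
  then have "(\<Sum>p\<in>?P (2 ^ Suc K) - ?P (2 ^ J). 1 / real (N p))
      = (\<Sum>p\<in>?P (2 ^ K) - ?P (2 ^ J). 1 / real (N p)) + (\<Sum>p\<in>?P (2 ^ Suc K) - ?P (2 ^ K). 1 / real (N p))"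
    by (simp only:) (rule sum.union_disjoint, auto)
  also have "(\<Sum>p\<in>?P (2 ^ Suc K) - ?P (2 ^ K). 1 / real (N p))
      \<le> (\<Sum>p\<in>?P (2 ^ Suc K) - ?P (2 ^ K). 1 / 2 ^ K)"
  proof (rule sum_mono)
    fix p assume "p \<in> ?P (2 ^ Suc K) - ?P (2 ^ K)"
    then have "real (2 ^ K) \<le> real (N p)"
      by (intro of_nat_mono) (auto simp: bounded_primes_def)
    then have "2 ^ K \<le> real (N p)" by simp
    moreover have "(0::real) < 2 ^ K" by simp
    ultimately show "1 / real (N p) \<le> 1 / 2 ^ K" by (intro frac_le) auto
  qed
  also have "\<dots> \<le> real (card (?P (2 ^ Suc K))) / 2 ^ K"
    by (simp add: divide_right_mono card_mono)
  also have "\<dots> \<le> 2 ^ Suc K * r ^ Suc K / 2 ^ K"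
    using bound[of "Suc K"] step.hyps by (intro divide_right_mono) auto
  also have "\<dots> = 2 * r ^ Suc K" by simp
  also have "\<dots> \<le> 2 / (1 - r) * (r ^ K - r ^ Suc K)"
  proof -
    have "2 / (1 - r) * (r ^ K - r ^ Suc K) = 2 * r ^ K"
      using r by (simp add: field_simps)
    then show ?thesis using r by simp
  qed
  finally have "(\<Sum>p\<in>?P (2 ^ Suc K) - ?P (2 ^ J). 1 / real (N p))
      \<le> (\<Sum>p\<in>?P (2 ^ K) - ?P (2 ^ J). 1 / real (N p)) + 2 / (1 - r) * (r ^ K - r ^ Suc K)"
    by simp
  moreover have "2 / (1 - r) * (r ^ J - r ^ Suc K)
      = 2 / (1 - r) * (r ^ J - r ^ K) + 2 / (1 - r) * (r ^ K - r ^ Suc K)"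
    by (simp add: algebra_simps diff_divide_distrib)
  ultimately show ?case using step.IH by linarith
qed simp

text \<open>If there were fewer primes then the reciprocals of their norms would be summable, and Erdos's
  sieve estimate would leave too few elements of bounded norm.\<close>

lemma many_primes:
  assumes e: "0 < e" "e < 1"
  shows "\<exists>n\<ge>n0. real (card (bounded_primes n)) > real n powr (1 - e)"
proof (rule ccontr)
  assume "\<not> ?thesis"
  then have few: "real (card (bounded_primes n)) \<le> real n powr (1 - e)" if "n \<ge> n0" for n
    using that by force
  \<comment> \<open>With this \<open>r\<close> the bound \<open>(2 ^ j) powr (1 - e)\<close> becomes
    \<open>2 ^ j * r ^ j\<close>.\<close>
  define r where "r = 2 powr (-e)"
  have r: "0 < r" "r < 1" using e by (auto simp: r_def intro: powr_less_one)
  have bound: "real (card (bounded_primes (2 ^ j))) \<le> 2 ^ j * r ^ j" if "j \<ge> n0" for j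
  proof -
    have "j < 2 ^ j" by (rule less_exp)
    then have "real (card (bounded_primes (2 ^ j))) \<le> real (2 ^ j) powr (1 - e)"
      using that by (intro few) linarith
    also have "\<dots> = 2 powr (j * (1 - e))" by (simp add: powr_realpow[symmetric] powr_powr)
    also have "\<dots> = 2 ^ j * r ^ j"
      by (simp add: r_def powr_realpow[symmetric] powr_powr powr_add[symmetric] algebra_simps)
    finally show ?thesis .
  qed
  define c where "c = real (C\<^sup>2)"
  have c: "c > 0" using C_pos by (simp add: c_def)
  \<comment> \<open>\<open>J\<close> is chosen first, so large that the primes of norm above
    \<open>2 ^ J\<close> contribute less than \<open>m^2 / 2\<close> to the sieve bound whatever
    \<open>m\<close> is. Only then is \<open>m\<close> chosen, so large that the remaining part
    \<open>B * m\<close> is also less than \<open>m^2 / 2\<close>.\<close>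
  have "(\<lambda>j. c * (2 / (1 - r) * r ^ j)) \<longlonglongrightarrow> c * (2 / (1 - r) * 0)"
    using r by (intro tendsto_intros LIMSEQ_realpow_zero) auto
  then have "eventually (\<lambda>j. c * (2 / (1 - r) * r ^ j) < 1 / 2) sequentially"
    by (rule order_tendstoD) simp
  then obtain J where J: "J \<ge> n0" "c * (2 / (1 - r) * r ^ J) < 1 / 2"
    unfolding eventually_sequentially by (metis nle_le)
  define B where "B = c * 2 ^ card (bounded_primes (2 ^ J))"
  obtain m where m: "real m > 2 * B" using reals_Archimedean2 by blast
  have "B \<ge> 0" using c by (simp add: B_def)
  with m have m0: "m > 0" by (cases m) auto
  \<comment> \<open>\<open>m^2 \<le> K < 2 ^ K\<close>, so the dyadic estimate reaches all primes of
    norm up to \<open>m^2\<close>.\<close>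
  define K where "K = max J (m\<^sup>2)"
  have "m\<^sup>2 \<le> 2 ^ K"
    using less_exp[of K] max.cobounded2[of "m\<^sup>2" J] unfolding K_def by linarith
  have "(\<Sum>p\<in>bounded_primes (m\<^sup>2) - bounded_primes (2 ^ J). 1 / real (N p))
      \<le> (\<Sum>p\<in>bounded_primes (2 ^ K) - bounded_primes (2 ^ J). 1 / real (N p))"
    using \<open>m\<^sup>2 \<le> 2 ^ K\<close> by (intro sum_mono2) (simp, force simp: bounded_primes_def, simp)
  also have "\<dots> \<le> 2 / (1 - r) * (r ^ J - r ^ K)"
    using r J bound by (intro sum_inverse_primes_le) (auto simp: K_def)
  also have "\<dots> \<le> 2 / (1 - r) * r ^ J"
    using r by (intro mult_left_mono) auto
  finally have tail: "(\<Sum>p\<in>bounded_primes (m\<^sup>2) - bounded_primes (2 ^ J). 1 / real (N p))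
      \<le> 2 / (1 - r) * r ^ J" .
  have "real (m\<^sup>2) \<le> c * (2 ^ card (bounded_primes (2 ^ J)) * m
      + real (m\<^sup>2) * (\<Sum>p\<in>bounded_primes (m\<^sup>2) - bounded_primes (2 ^ J). 1 / real (N p)))"
    using Erdos_sieve_bound[of m "2 ^ J"] by (simp add: c_def sum_distrib_left)
  also have "\<dots> \<le> c * (2 ^ card (bounded_primes (2 ^ J)) * m + real (m\<^sup>2) * (2 / (1 - r) * r ^ J))"
    using c tail by (intro mult_left_mono add_left_mono) auto
  also have "\<dots> = B * m + real (m\<^sup>2) * (c * (2 / (1 - r) * r ^ J))"
    by (simp add: B_def algebra_simps)
  also have "\<dots> < real m / 2 * m + real (m\<^sup>2) * (1 / 2)"
    using m m0 J by (intro add_strict_mono mult_strict_right_mono mult_strict_left_mono) auto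
  also have "\<dots> = real (m\<^sup>2)" by (simp add: power2_eq_square)
  finally show False by simp
qed

subsection \<open>The maximal order\<close>

text \<open>For the square \<open>x\<close> of the product of the \<open>k\<close> primes of norm at
  most \<open>n\<close>, \<open>ln (mult_fun F x) = k * ln M\<close> and
  \<open>L = ln (N x) \<le> 2 * k * ln n\<close>. From \<open>L \<ge> k > n powr (1 - e)\<close>
  also \<open>ln L \<ge> (1 - e) * ln n\<close>, and the factors \<open>k\<close> and
  \<open>ln n\<close> cancel in the quotient.\<close>

lemma mult_fun_often_large:
  assumes "F 2 = M" "M \<ge> 1" and e: "0 < e" "e < 1"
  shows "\<exists>x. x \<noteq> 0 \<and> N x \<ge> n0 \<and>
    ln (real (mult_fun F x)) * ln (ln (real (N x))) / ln (real (N x)) \<ge> (1 - e) * (ln (real M) / 2)"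
proof -
  \<comment> \<open>This makes \<open>k\<close> exceed \<open>n0 + 1\<close>; the required size of
    \<open>N x\<close> then follows from \<open>k \<le> L \<le> N x - 1\<close>.\<close>
  have "eventually (\<lambda>n::nat. real n powr (1 - e) \<ge> real n0 + 1) at_top"
    using e by real_asymp
  then obtain n1 where n1: "\<And>n. n \<ge> n1 \<Longrightarrow> real n powr (1 - e) \<ge> real n0 + 1"
    unfolding eventually_sequentially by blast
  obtain n where n: "n \<ge> max n1 2" "real (card (bounded_primes n)) > real n powr (1 - e)"
    using many_primes[OF e] by blast
  define P where "P = bounded_primes n"
  have finP: "finite P" by (simp add: P_def)
  have primeP: "prime p" "N p \<le> n" if "p \<in> P" for p using that by (auto simp: P_def bounded_primes_def)
  define x where "x = (\<Prod>p\<in>P. p ^ 2)"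
  have x0: "x \<noteq> 0" using finP primeP(1) not_prime_0 unfolding x_def by (metis power_not_zero prod_zero_iff)
  have mult: "multiplicity p x = (if p \<in> P then 2 else 0)" if "prime p" for p
    unfolding x_def using finP primeP that by (intro multiplicity_prod_prime_powers) auto
  have pf: "prime_factors x = P"
    using mult primeP(1) by (auto simp: prime_factors_multiplicity split: if_splits)
  define k where "k = real (card P)"
  have k: "k > real n powr (1 - e)" using n by (simp add: k_def P_def)
  with n1[of n] n have k1: "k > real n0 + 1" by simp
  have f: "ln (real (mult_fun F x)) = k * ln (real M)"
  proof -
    have "mult_fun F x = (\<Prod>p\<in>P. M)"
      unfolding mult_fun_def pf by (intro prod.cong refl) (use mult primeP assms in auto)
    then show ?thesis using assms by (simp add: ln_realpow k_def)
  qed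
  define L where "L = ln (real (N x))"
  have L: "L = (\<Sum>p\<in>P. 2 * ln (real (N p)))"
    unfolding L_def ln_N_factorization[OF x0] pf
    by (intro sum.cong refl) (use mult primeP in auto)
  have "L \<le> (\<Sum>p\<in>P. 2 * ln (real n))"
    unfolding L using primeP N_prime_ge_2 by (intro sum_mono mult_left_mono ln_mono) fastforce+
  then have L_upper: "L \<le> 2 * k * ln (real n)" by (simp add: k_def)
  \<comment> \<open>Since \<open>2 * ln 2 > 1\<close>, every prime adds at least 1 to
    \<open>L\<close>.\<close>
  have ln2: "ln 2 > (1 / 2 :: real)" using ln_2_less_1 ln2_ge_two_thirds by linarith
  have "(\<Sum>p\<in>P. 1) \<le> L"
    unfolding L
  proof (rule sum_mono)
    fix p assume "p \<in> P"
    then have "ln (real (N p)) \<ge> ln 2" using primeP N_prime_ge_2[of p] by (intro ln_mono) auto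
    with ln2 show "1 \<le> 2 * ln (real (N p))" by linarith
  qed
  then have L_lower: "k \<le> L" by (simp add: k_def)
  have "L > 0" using L_lower k1 by linarith
  have lnn: "ln (real n) > 0" using n by simp
  have "(1 - e) * ln (real n) = ln (real n powr (1 - e))" using n by (simp add: ln_powr)
  also have "\<dots> \<le> ln L" using k L_lower n by (intro ln_mono) auto
  finally have lnL: "(1 - e) * ln (real n) \<le> ln L" .
  have "(1 - e) * (ln (real M) / 2) = k * ln (real M) * ((1 - e) * ln (real n)) / (2 * k * ln (real n))"
    using lnn k1 by simp
  also have "\<dots> \<le> k * ln (real M) * ((1 - e) * ln (real n)) / L"
    using L_upper \<open>L > 0\<close> k1 assms(2) e lnn by (intro divide_left_mono mult_nonneg_nonneg mult_pos_pos) auto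
  also have "\<dots> \<le> k * ln (real M) * ln L / L"
    using lnL \<open>L > 0\<close> k1 assms(2) by (intro divide_right_mono mult_left_mono mult_nonneg_nonneg) auto
  finally have main: "(1 - e) * (ln (real M) / 2) \<le> k * ln (real M) * ln L / L" .
  have "L \<le> real (N x) - 1" unfolding L_def using x0 by (intro ln_le_minus_one) (simp add: zero_less_iff_neq_zero)
  with L_lower k1 have "N x \<ge> n0" by linarith
  with main x0 show ?thesis by (intro exI[of _ x]) (simp only: f L_def, simp)
qed

text \<open>\<open>F m ^ 2 \<le> M ^ m\<close> expresses \<open>F m \<le> M ^ (m / 2)\<close> within
  the natural numbers. It is applied to the primes of large norm; the primes of small norm are few
  but may have exponents of order \<open>L\<close>, and for them the polynomial bound is the
  effective one.\<close>

lemma mult_fun_eventually_small: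
  fixes F :: "nat \<Rightarrow> nat"
  assumes F1: "\<And>m. m \<ge> 1 \<Longrightarrow> F m \<ge> 1" and FM: "\<And>m. m \<ge> 1 \<Longrightarrow> F m ^ 2 \<le> M ^ m"
    and FD: "\<And>m. m \<ge> 1 \<Longrightarrow> F m \<le> D * m ^ c" and e: "e > 0"
  shows "\<exists>n0. \<forall>x. N x \<ge> n0 \<longrightarrow>
    ln (real (mult_fun F x)) * ln (ln (real (N x))) / ln (real (N x)) \<le> ln (real M) / 2 + e"
proof -
  have "M \<ge> 1" using F1[of 1] FM[of 1] by (cases M) auto
  have "D \<ge> 1" using F1[of 1] FD[of 1] by (cases D) auto
  have lM: "ln (real M) \<ge> 0" using \<open>M \<ge> 1\<close> by simp
  \<comment> \<open>First summand: at most \<open>C * L powr (1 - d)\<close> primes of small norm,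
    each with exponent at most \<open>L / ln 2\<close>. Second summand: the exponents of the other
    primes add up to at most \<open>L / ((1 - d) * ln L)\<close>. The factor \<open>ln L / L\<close>
    is the normalization in the limit.\<close>
  define g where "g d L = (C * L powr (1 - d) * (ln D + c * ln (L / ln 2))
      + ln M / 2 * (L / ((1 - d) * ln L))) * ln L / L" for d L :: real
  have main: "ln (real (mult_fun F x)) * ln (ln (real (N x))) / ln (real (N x)) \<le> g d (ln (real (N x)))"
    if d: "0 < d" "d < 1" and large: "ln (real (N x)) > 1" for d x
  proof -
    define L where "L = ln (real (N x))"
    have L: "L > 1" using large by (simp add: L_def)
    \<comment> \<open>\<open>N 0 = 0\<close> and \<open>ln 0 = 0\<close>, so \<open>large\<close>
      rules out \<open>x = 0\<close>.\<close>
    have x0: "x \<noteq> 0" using large N_eq_0_iff[of x] by (intro notI) (simp del: N_eq_0_iff)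
    let ?pf = "prime_factors x"
    let ?m = "\<lambda>p. multiplicity p x"
    define y where "y = L powr (1 - d)"
    have y: "y > 0" using L by (simp add: y_def)
    define S where "S = {p \<in> ?pf. real (N p) \<le> y}"
    define B where "B = {p \<in> ?pf. real (N p) > y}"
    have m1: "?m p \<ge> 1" if "p \<in> ?pf" for p
      using that by (auto simp: prime_factors_multiplicity)
    have np: "N p \<ge> 2" if "p \<in> ?pf" for p
      using that N_prime_ge_2 by auto
    have sumL: "(\<Sum>p\<in>T. ?m p * ln (real (N p))) \<le> L" if "T \<subseteq> ?pf" for T
      unfolding L_def ln_N_factorization[OF x0]
      using that np by (intro sum_mono2) (auto intro!: mult_nonneg_nonneg ln_ge_zero dest: np)
    have split: "?pf = S \<union> B" "S \<inter> B = {}" "finite S" "finite B" by (auto simp: S_def B_def)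
    have "ln (real (mult_fun F x)) = (\<Sum>p\<in>?pf. ln (F (?m p)))"
      unfolding mult_fun_def of_nat_prod
      by (rule ln_prod) (use F1 m1 in \<open>force+\<close>)
    also have "\<dots> = (\<Sum>p\<in>S. ln (F (?m p))) + (\<Sum>p\<in>B. ln (F (?m p)))"
      using split by (simp add: sum.union_disjoint)
    also have "(\<Sum>p\<in>S. ln (F (?m p))) \<le> (\<Sum>p\<in>S. ln D + c * ln (L / ln 2))"
    proof (rule sum_mono)
      fix p assume "p \<in> S"
      then have p: "p \<in> ?pf" by (auto simp: S_def)
      have "?m p * ln 2 \<le> ?m p * ln (real (N p))"
        using np[OF p] by (intro mult_left_mono ln_mono) auto
      also have "\<dots> \<le> L" using sumL[of "{p}"] p by simp
      finally have mp: "?m p \<le> L / ln 2" by (simp add: field_simps)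
      have "ln (F (?m p)) \<le> ln (real (D * ?m p ^ c))"
        using F1[OF m1[OF p]] of_nat_mono[OF FD[OF m1[OF p]], where 'a = real] by (intro ln_mono) auto
      also have "\<dots> = ln D + c * ln (?m p)"
        using \<open>D \<ge> 1\<close> m1[OF p] by (simp add: ln_mult ln_realpow)
      also have "\<dots> \<le> ln D + c * ln (L / ln 2)"
        using mp m1[OF p] by (intro add_left_mono mult_left_mono ln_mono) auto
      finally show "ln (F (?m p)) \<le> ln D + c * ln (L / ln 2)" .
    qed
    also have "\<dots> = card S * (ln D + c * ln (L / ln 2))" by simp
    also have "\<dots> \<le> C * y * (ln D + c * ln (L / ln 2))"
    proof (rule mult_right_mono)
      have "S \<subseteq> bounded_elems (nat \<lfloor>y\<rfloor>)"
        using x0 by (auto simp: S_def bounded_elems_def in_prime_factors_iff le_nat_floor)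
      then have "card S \<le> C * nat \<lfloor>y\<rfloor>"
        using card_bounded_elems_le card_mono[OF finite_bounded_elems] order.trans by blast
      then have "real (card S) \<le> C * real (nat \<lfloor>y\<rfloor>)"
        by (metis of_nat_le_iff of_nat_mult)
      also have "\<dots> \<le> C * y" using y by (intro mult_left_mono) auto
      finally show "real (card S) \<le> C * y" .
      have "ln 2 \<le> L" using L ln_2_less_1 by linarith
      then have "ln (L / ln 2) \<ge> 0" by simp
      then show "0 \<le> ln D + c * ln (L / ln 2)" using \<open>D \<ge> 1\<close> by simp
    qed
    also have "(\<Sum>p\<in>B. ln (F (?m p))) \<le> ln M / 2 * (\<Sum>p\<in>B. real (?m p))"
      unfolding sum_distrib_left
    proof (rule sum_mono)
      fix p assume "p \<in> B"
      then have p: "p \<in> ?pf" by (auto simp: B_def)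
      have "real (F (?m p)) ^ 2 \<le> real M ^ ?m p"
        using FM[OF m1[OF p]] by (metis of_nat_le_iff of_nat_power)
      then have "ln (real (F (?m p)) ^ 2) \<le> ln (real M ^ ?m p)"
        using F1[OF m1[OF p]] by (intro ln_mono) auto
      then show "ln (F (?m p)) \<le> ln M / 2 * ?m p"
        using F1[OF m1[OF p]] \<open>M \<ge> 1\<close> by (simp add: ln_realpow mult.commute)
    qed
    also have "(\<Sum>p\<in>B. real (?m p)) \<le> L / ((1 - d) * ln L)"
    proof -
      have lnL: "ln L > 0" using L by simp
      \<comment> \<open>\<open>ln y = (1 - d) * ln L\<close>, and each prime in \<open>B\<close> has
        norm above \<open>y\<close>.\<close>
      have "(\<Sum>p\<in>B. real (?m p)) * ((1 - d) * ln L) = (\<Sum>p\<in>B. ?m p * ln y)"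
        using L by (simp add: y_def ln_powr sum_distrib_right)
      also have "\<dots> \<le> (\<Sum>p\<in>B. ?m p * ln (real (N p)))"
        using y by (intro sum_mono mult_left_mono ln_mono) (auto simp: B_def)
      also have "\<dots> \<le> L" by (rule sumL) (auto simp: B_def)
      finally show ?thesis using lnL d by (simp add: pos_le_divide_eq)
    qed
    finally have "ln (real (mult_fun F x)) \<le> C * y * (ln D + c * ln (L / ln 2))
       + ln M / 2 * (L / ((1 - d) * ln L))" using lM by (simp add: mult_left_mono)
    then show ?thesis using L unfolding g_def y_def L_def[symmetric]
      by (intro divide_right_mono mult_right_mono) auto
  qed
  \<comment> \<open>With this \<open>d\<close> the limit \<open>ln M / (2 * (1 - d))\<close> of
    \<open>g d\<close> equals \<open>(ln M / 2 + e) * ln M / (ln M + e)\<close>, which is strictly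
    below \<open>ln M / 2 + e\<close>.\<close>
  define d where "d = e / (ln M + 2 * e)"
  have d: "0 < d" "d < 1" using e lM by (auto simp: d_def field_simps)
  have "((g d) \<longlongrightarrow> ln M * inverse (1 - d) / 2) at_top"
    unfolding g_def using d by real_asymp
  moreover have "ln M * inverse (1 - d) / 2 < ln M / 2 + e"
    using e lM by (simp add: d_def field_simps add_pos_nonneg)
  ultimately have ev: "eventually (\<lambda>L. g d L < ln M / 2 + e) at_top"
    by (rule order_tendstoD)
  have lim: "filterlim (\<lambda>n::nat. ln (real n)) at_top at_top" by real_asymp
  have "eventually (\<lambda>n::nat. g d (ln (real n)) < ln M / 2 + e \<and> ln (real n) > 1) at_top"
    using eventually_compose_filterlim[OF eventually_conj[OF ev eventually_gt_at_top[of 1]] lim] .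
  then obtain n0 where "\<And>n. n \<ge> n0 \<Longrightarrow> g d (ln (real n)) < ln M / 2 + e \<and> ln (real n) > 1"
    unfolding eventually_sequentially by blast
  then show ?thesis using main[OF d] by (intro exI[of _ n0]) fastforce
qed

end

subsection \<open>Ordered factorizations\<close>

context normed_ufd
begin

text \<open>Normalized entries stand for associate classes. The count is \<open>tau k a\<close> over
  \<open>nat\<close>, and \<open>ttau k a\<close> over the Gaussian integers if \<open>a\<close>
  comes from a natural number.\<close>

definition tuples :: "nat \<Rightarrow> 'a \<Rightarrow> 'a list set" where
  "tuples k a = {ds. length ds = k \<and> (\<forall>d\<in>set ds. normalize d = d \<and> d \<noteq> 0)
     \<and> normalize (prod_list ds) = normalize a}"

definition num_tuples :: "nat \<Rightarrow> 'a \<Rightarrow> nat" where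
  "num_tuples k a = card (tuples k a)"

definition divs :: "'a \<Rightarrow> 'a set" where
  "divs a = {d. normalize d = d \<and> d dvd a}"

lemma finite_divs [simp]: "a \<noteq> 0 \<Longrightarrow> finite (divs a)"
  by (rule finite_subset[OF _ finite_bounded_elems[of "N a"]])
     (auto simp: divs_def bounded_elems_def dvd_imp_N_le)

lemma Cons_in_tuplesI:
  assumes "ds \<in> tuples k a" "d \<noteq> 0"
  shows "normalize d # ds \<in> tuples (Suc k) (d * a)"
proof -
  have "normalize (normalize d * prod_list ds) = normalize (d * normalize (prod_list ds))" by simp
  also have "\<dots> = normalize (d * a)" using assms by (simp add: tuples_def)
  finally show ?thesis using assms by (auto simp: tuples_def)
qed

lemma tuples_SucE:
  assumes "ds \<in> tuples (Suc k) a" "a \<noteq> 0"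
  obtains d es c where "ds = d # es" "a = d * c" "normalize d = d" "es \<in> tuples k c"
proof -
  obtain d es where ds: "ds = d # es" using assms by (cases ds) (auto simp: tuples_def)
  have d: "normalize d = d" "d \<noteq> 0" "normalize (d * prod_list es) = normalize a"
    using assms by (auto simp: tuples_def ds)
  then have "d dvd a" by (metis dvd_normalize_iff dvd_triv_left)
  then obtain c where c: "a = d * c" by auto
  have "normalize (prod_list es) = normalize c"
    using d c by (simp add: associated_iff_dvd)
  then have "es \<in> tuples k c" using assms by (auto simp: tuples_def ds)
  with ds c d that show ?thesis by blast
qed

lemma tuples_0: "tuples 0 a = (if is_unit a then {[]} else {})"
  by (auto simp: tuples_def is_unit_normalize associated_iff_dvd)

lemma tuples_Suc:
  assumes "a \<noteq> 0"
  shows "tuples (Suc k) a = (\<Union>d\<in>divs a. (#) d ` tuples k (a div d))"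
proof (intro equalityI subsetI)
  fix ds assume "ds \<in> tuples (Suc k) a"
  then obtain d es c where *: "ds = d # es" "a = d * c" "normalize d = d" "es \<in> tuples k c"
    using assms tuples_SucE by blast
  with assms have "d \<noteq> 0" by auto
  with * show "ds \<in> (\<Union>d\<in>divs a. (#) d ` tuples k (a div d))" by (auto simp: divs_def)
next
  fix ds assume "ds \<in> (\<Union>d\<in>divs a. (#) d ` tuples k (a div d))"
  then obtain d es where *: "ds = d # es" "d dvd a" "normalize d = d" "es \<in> tuples k (a div d)"
    by (auto simp: divs_def)
  with assms have "d \<noteq> 0" by auto
  with * show "ds \<in> tuples (Suc k) a" using Cons_in_tuplesI[of es k "a div d" d] by simp
qed

lemma finite_tuples [simp]: "a \<noteq> 0 \<Longrightarrow> finite (tuples k a)"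
proof (induction k arbitrary: a)
  case (Suc k)
  have "finite ((#) d ` tuples k (a div d))" if "d \<in> divs a" for d
    using that Suc by (intro finite_imageI Suc.IH) (auto simp: divs_def dvd_div_eq_0_iff)
  with Suc.prems show ?case unfolding tuples_Suc[OF Suc.prems]
    by (intro finite_UN_I finite_divs) auto
qed (simp add: tuples_0)

text \<open>The first entry runs over the divisor classes of \<open>a\<close>, and different first
  entries give disjoint sets. The exact counts below follow from this recursion by induction on
  \<open>k\<close>.\<close>

lemma num_tuples_Suc:
  assumes "a \<noteq> 0"
  shows "num_tuples (Suc k) a = (\<Sum>d\<in>divs a. num_tuples k (a div d))"
proof -
  have "card (\<Union>d\<in>divs a. (#) d ` tuples k (a div d)) = (\<Sum>d\<in>divs a. card ((#) d ` tuples k (a div d)))"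
    using assms
    by (intro card_UN_disjoint finite_divs ballI finite_imageI finite_tuples)
       (auto simp: divs_def dvd_div_eq_0_iff)
  also have "\<dots> = (\<Sum>d\<in>divs a. num_tuples k (a div d))"
    by (intro sum.cong refl) (auto simp: card_image num_tuples_def)
  finally show ?thesis by (simp add: num_tuples_def tuples_Suc assms)
qed

lemma num_tuples_cong: "normalize a = normalize b \<Longrightarrow> num_tuples k a = num_tuples k b"
  by (simp add: num_tuples_def tuples_def)

lemma num_tuples_unit:
  assumes "is_unit u"
  shows "num_tuples k u = 1"
proof -
  have divs1: "divs 1 = {1}"
    by (auto simp: divs_def) (metis is_unit_normalize)
  have "num_tuples k 1 = 1"
    by (induction k) (simp_all add: num_tuples_Suc divs1, simp add: num_tuples_def tuples_0)
  moreover have "normalize u = normalize 1" using assms by (simp add: is_unit_normalize)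
  ultimately show ?thesis by (metis num_tuples_cong)
qed

lemma num_tuples_0: "num_tuples 0 a = (if is_unit a then 1 else 0)"
  by (simp add: num_tuples_def tuples_0)

text \<open>Exactly one of the \<open>k\<close> entries carries the prime, the others are
  units.\<close>

lemma num_tuples_prime:
  assumes "prime_elem p"
  shows "num_tuples k p = k"
proof -
  define q where "q = normalize p"
  have q: "prime q" using assms by (simp add: q_def)
  have q0: "q \<noteq> 0" "q \<noteq> 1" "\<not> is_unit q" using q by (auto simp: not_prime_unit)
  have divs: "divs q = {1, q}"
  proof (intro equalityI subsetI)
    fix d assume "d \<in> divs q"
    then have d: "normalize d = d" "d dvd q ^ 1" by (auto simp: divs_def)
    then obtain m where "m \<le> 1" "normalize d = normalize (q ^ m)"
      using divides_primepow_weak[OF q] by blast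
    with d q show "d \<in> {1, q}" by (cases m) (auto simp: le_Suc_eq normalize_prime)
  qed (use q in \<open>auto simp: divs_def normalize_prime\<close>)
  have "num_tuples k q = k"
    by (induction k) (use q0 in \<open>simp_all add: num_tuples_0 num_tuples_Suc divs num_tuples_unit\<close>)
  then show ?thesis using num_tuples_cong[of p q k] by (simp add: q_def)
qed

text \<open>The first entry is \<open>1\<close>, \<open>p\<close> or the square, which gives the
  recursion \<open>T (k + 1) = T k + k + 1\<close>. The square of a normalized element need not be
  normalized, as \<open>(1 + \<i>)^2 = 2 * \<i>\<close> shows; hence \<open>?q\<close>.\<close>

lemma num_tuples_prime_square:
  assumes "prime p"
  shows "num_tuples k (p\<^sup>2) = (k + 1) choose 2"
proof -
  have p: "p \<noteq> 0" "p \<noteq> 1" "\<not> is_unit p" "normalize p = p"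
    using assms by (auto simp: not_prime_unit normalize_prime)
  let ?q = "normalize (p\<^sup>2)"
  have divs: "divs (p\<^sup>2) = {1, p, ?q}"
  proof (intro equalityI subsetI)
    fix d assume "d \<in> divs (p\<^sup>2)"
    then have d: "normalize d = d" "d dvd p ^ 2" by (auto simp: divs_def)
    then obtain m where "m \<le> 2" "normalize d = normalize (p ^ m)"
      using divides_primepow_weak[OF assms] by blast
    with d p show "d \<in> {1, p, ?q}" by (auto simp: le_Suc_eq numeral_2_eq_2)
  qed (use p in \<open>auto simp: divs_def\<close>)
  \<comment> \<open>The norms tell the three divisors apart.\<close>
  have "N p \<ge> 2" by (rule N_prime_ge_2[OF assms])
  then have "N 1 < N p" "N p < N ?q" by (auto simp: power2_eq_square N_mult)
  then have distinct: "p \<noteq> ?q" "1 \<noteq> ?q" by (metis less_irrefl order.strict_trans)+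
  have unit: "is_unit (p\<^sup>2 div ?q)"
    using p by (metis unit_factor_is_unit zero_eq_power2 div_normalize)
  show ?thesis
  proof (induction k)
    case (Suc k)
    have "num_tuples (Suc k) (p\<^sup>2) = num_tuples k (p\<^sup>2) + num_tuples k (p\<^sup>2 div p) + num_tuples k (p\<^sup>2 div ?q)"
      using p distinct by (simp add: num_tuples_Suc divs)
    also have "p\<^sup>2 div p = p" using p by (simp add: power2_eq_square)
    also have "num_tuples k p = k" using assms by (intro num_tuples_prime) auto
    finally show ?case using Suc unit by (simp add: num_tuples_unit numeral_2_eq_2)
  qed (use p in \<open>simp add: num_tuples_0 is_unit_power_iff\<close>)
qed

section \<open>Submultiplicativity and bounds for the number of factorizations\<close>

text \<open>The first entry divides \<open>x * y\<close>, so it splits as \<open>e * f\<close> with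
  \<open>e dvd x\<close> and \<open>f dvd y\<close>; induction handles the cofactors. Every tuple
  for \<open>x * y\<close> is thus an entrywise product, which is the source of
  submultiplicativity.\<close>

lemma tuples_refine:
  assumes "x \<noteq> 0" "y \<noteq> 0" "ds \<in> tuples k (x * y)"
  shows "\<exists>es\<in>tuples k x. \<exists>fs\<in>tuples k y. ds = map2 (\<lambda>e f. normalize (e * f)) es fs"
  using assms
proof (induction k arbitrary: x y ds)
  case 0
  then show ?case by (auto simp: tuples_0 is_unit_mult_iff split: if_splits)
next
  case (Suc k)
  have xy: "x * y \<noteq> 0" using Suc.prems by simp
  obtain d ds' c where ds: "ds = d # ds'" "x * y = d * c" "normalize d = d" "ds' \<in> tuples k c"
    by (rule tuples_SucE[OF Suc.prems(3) xy])
  then have "d dvd x * y" by simp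
  then obtain e f where ef: "d = e * f" "e dvd x" "f dvd y" using division_decomp by blast
  then obtain x' y' where x': "x = e * x'" "y = f * y'" by (auto elim!: dvdE)
  have nz: "e \<noteq> 0" "f \<noteq> 0" "x' \<noteq> 0" "y' \<noteq> 0" using x' Suc.prems by auto
  have "d * c = d * (x' * y')" using ds ef x' by (simp add: mult_ac)
  then have "c = x' * y'" using ef nz by simp
  then obtain es fs where "es \<in> tuples k x'" "fs \<in> tuples k y'"
    "ds' = map2 (\<lambda>e f. normalize (e * f)) es fs"
    using Suc.IH[of x' y' ds'] ds nz by auto
  moreover from this have "normalize e # es \<in> tuples (Suc k) x" "normalize f # fs \<in> tuples (Suc k) y"
    using nz unfolding x' by (auto intro: Cons_in_tuplesI)
  moreover have "normalize (normalize e * normalize f) = d" using ds ef by simp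
  ultimately show ?case using ds
    by (intro bexI[of _ "normalize e # es"] bexI[of _ "normalize f # fs"]) simp_all
qed

lemma num_tuples_mult_le:
  assumes "x \<noteq> 0" "y \<noteq> 0"
  shows "num_tuples k (x * y) \<le> num_tuples k x * num_tuples k y"
proof -
  have "tuples k (x * y) \<subseteq> (\<lambda>(es, fs). map2 (\<lambda>e f. normalize (e * f)) es fs) ` (tuples k x \<times> tuples k y)"
    using tuples_refine[OF assms] by fast
  then have "card (tuples k (x * y)) \<le> card (tuples k x \<times> tuples k y)"
    using assms by (intro surj_card_le) auto
  then show ?thesis by (simp add: num_tuples_def card_cartesian_product)
qed

text \<open>Every entry divides \<open>a\<close>, so its norm is at most \<open>N a\<close> and
  there are at most \<open>C * N a\<close> choices for it. This crude estimate provides the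
  polynomial growth.\<close>

lemma num_tuples_le_power:
  assumes "a \<noteq> 0"
  shows "num_tuples k a \<le> (C * N a) ^ k"
proof -
  have "tuples k a \<subseteq> {ds. set ds \<subseteq> bounded_elems (N a) \<and> length ds = k}"
  proof
    fix ds assume ds: "ds \<in> tuples k a"
    have "N d \<le> N a" if "d \<in> set ds" for d
    proof (rule dvd_imp_N_le[OF _ assms])
      have "d dvd prod_list ds" using that by (rule prod_list_dvd)
      also have "prod_list ds dvd a" using ds by (simp add: tuples_def associated_iff_dvd)
      finally show "d dvd a" .
    qed
    with ds show "ds \<in> {ds. set ds \<subseteq> bounded_elems (N a) \<and> length ds = k}"
      by (auto simp: tuples_def bounded_elems_def)
  qed
  then have "num_tuples k a \<le> card (bounded_elems (N a)) ^ k"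
    unfolding num_tuples_def
    by (subst card_lists_length_eq[symmetric]) (auto intro!: card_mono finite_lists_length_eq)
  also have "\<dots> \<le> (C * N a) ^ k" by (intro power_mono card_bounded_elems_le) auto
  finally show ?thesis .
qed

lemma num_tuples_pos:
  assumes "a \<noteq> 0" "k \<ge> 1"
  shows "num_tuples k a \<ge> 1"
proof -
  obtain j where k: "k = Suc j" using assms by (cases k) auto
  have "tuples j 1 \<noteq> {}" using num_tuples_unit[of 1 j] by (auto simp: num_tuples_def)
  then have "tuples k a \<noteq> {}" using Cons_in_tuplesI[of _ j 1 a] assms by (auto simp: k)
  then show ?thesis using assms by (simp add: num_tuples_def Suc_le_eq card_gt_0_iff)
qed

lemma prime_norm_imp_prime_elem:
  assumes "prime (N x)"
  shows "prime_elem x"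
proof (rule irreducible_imp_prime_elem, rule irreducibleI)
  show "x \<noteq> 0" using assms by (metis N_eq_0_iff not_prime_0)
  show "\<not> is_unit x" using assms N_unit by force
  fix a b assume "x = a * b"
  with assms have "N a = 1 \<or> N b = 1" by (metis N_mult prime_product)
  then show "is_unit a \<or> is_unit b" by (simp only: N_eq_1_iff)
qed

text \<open>A prime factor of \<open>x\<close> has norm \<open>q\<close> or \<open>q^2\<close>, so
  \<open>x\<close> is a product of two prime elements or is associated to one. Split and inert
  rational primes are thus treated together, without a distinction modulo 4.\<close>

lemma num_tuples_norm_prime_square:
  assumes "prime q" "N x = q\<^sup>2"
  shows "num_tuples k x \<le> k\<^sup>2"
proof -
  have q: "q \<ge> 2" using assms prime_ge_2_nat by blast
  have "x \<noteq> 0" using assms(2) q N_eq_0_iff[of x] by (intro notI) simp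
  have "\<not> is_unit x"
  proof
    assume "is_unit x"
    then have "q\<^sup>2 = 1" using N_unit assms by simp
    with q show False by simp
  qed
  then obtain p where p: "prime p" "p dvd x" using prime_divisorE \<open>x \<noteq> 0\<close> by blast
  then obtain y where y: "x = p * y" by auto
  have Npy: "N p * N y = q\<^sup>2" using assms y by (simp add: N_mult)
  then have "N p dvd q\<^sup>2" by (metis dvd_triv_left)
  then obtain i where i: "i \<le> 2" "N p = q ^ i" using divides_primepow_nat assms by blast
  have "num_tuples k y \<le> k \<or> is_unit y"
  proof -
    have "i \<noteq> 0" using N_prime_ge_2[OF p(1)] i by (intro notI) auto
    with i consider "i = 1" | "i = 2" by linarith
    then show ?thesis
    proof cases
      case 1
      then have "N y = q" using Npy i q by (simp add: power2_eq_square)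
      then have "prime_elem y" using prime_norm_imp_prime_elem assms by simp
      then show ?thesis using num_tuples_prime by simp
    next
      case 2
      then have "N y = 1" using Npy i q by simp
      then show ?thesis using N_eq_1_iff by simp
    qed
  qed
  moreover have "num_tuples k x \<le> num_tuples k p * num_tuples k y"
    unfolding y using p y \<open>x \<noteq> 0\<close> by (intro num_tuples_mult_le) auto
  moreover have "num_tuples k p = k" using p by (intro num_tuples_prime) auto
  ultimately show ?thesis
    by (cases "k = 0") (auto simp: num_tuples_unit power2_eq_square intro: order.trans mult_le_mono2)
qed

end

section \<open>An epsilon criterion for upper limits\<close>

text \<open>If the upper limit were below \<open>L\<close>, some real \<open>c\<close> would lie
  strictly between them; then eventually \<open>u x < c\<close>, against the lower hypothesis for
  \<open>e = L - c\<close>.\<close>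

lemma Limsup_ereal_eqI:
  fixes u :: "'b \<Rightarrow> real"
  assumes upper: "\<And>e. e > 0 \<Longrightarrow> eventually (\<lambda>x. u x \<le> L + e) G"
    and lower: "\<And>e. e > 0 \<Longrightarrow> frequently (\<lambda>x. L - e \<le> u x) G"
  shows "Limsup G (\<lambda>x. ereal (u x)) = ereal L"
proof (rule antisym)
  show "Limsup G (\<lambda>x. ereal (u x)) \<le> ereal L"
  proof (rule ereal_le_epsilon2)
    fix e :: real assume "e > 0"
    from upper[OF this] show "Limsup G (\<lambda>x. ereal (u x)) \<le> ereal L + ereal e"
      by (intro Limsup_bounded) simp
  qed
  show "ereal L \<le> Limsup G (\<lambda>x. ereal (u x))"
  proof (rule ccontr)
    assume "\<not> ?thesis"
    then obtain c where c: "Limsup G (\<lambda>x. ereal (u x)) < ereal c" "c < L"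
      using ereal_dense2[of "Limsup G (\<lambda>x. ereal (u x))" "ereal L"] by (auto simp: not_le)
    have "eventually (\<lambda>x. u x < c) G"
      using Limsup_lessD[OF c(1)] by simp
    moreover have "frequently (\<lambda>x. L - (L - c) \<le> u x) G"
      using c by (intro lower) simp
    ultimately have "frequently (\<lambda>x. u x < c \<and> L - (L - c) \<le> u x) G"
      by (rule frequently_eventually_conj[rotated])
    then show False by (auto dest: frequently_ex)
  qed
qed

subsection \<open>The upper limit\<close>

context normed_ufd
begin

text \<open>\<open>idx\<close> lets the limit run over another index type: the identity for
  \<open>nat\<close>, pairs of integers for the Gaussian integers. The condition on \<open>G\<close>
  says that \<open>G\<close> is the filter of norms tending to infinity.\<close>

lemma Limsup_mult_fun:
  fixes F :: "nat \<Rightarrow> nat" and idx :: "'b \<Rightarrow> 'a"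
  assumes F: "F 2 = M" "\<And>m. m \<ge> 1 \<Longrightarrow> F m \<ge> 1" "\<And>m. m \<ge> 1 \<Longrightarrow> F m ^ 2 \<le> M ^ m"
      "\<And>m. m \<ge> 1 \<Longrightarrow> F m \<le> D * m ^ c"
    and idx: "\<And>x. x \<noteq> 0 \<Longrightarrow> \<exists>b. idx b = x"
    and G: "\<And>P. eventually P G \<longleftrightarrow> (\<exists>n0. \<forall>b. N (idx b) \<ge> n0 \<longrightarrow> P b)"
  shows "Limsup G (\<lambda>b. ereal (ln (real (mult_fun F (idx b))) * ln (ln (real (N (idx b))))
           / ln (real (N (idx b))))) = ereal (ln (real M) / 2)"
proof (rule Limsup_ereal_eqI)
  fix e :: real assume e: "e > 0"
  obtain n0 where "\<forall>x. N x \<ge> n0 \<longrightarrow>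
      ln (real (mult_fun F x)) * ln (ln (real (N x))) / ln (real (N x)) \<le> ln (real M) / 2 + e"
    using mult_fun_eventually_small[OF F(2-4) e] by auto
  then show "eventually (\<lambda>b. ln (real (mult_fun F (idx b))) * ln (ln (real (N (idx b))))
      / ln (real (N (idx b))) \<le> ln (real M) / 2 + e) G"
    unfolding G by blast
  have M: "M \<ge> 1" using F(2)[of 2] by (simp add: F(1))
  define L where "L = ln (real M) / 2"
  have L: "L \<ge> 0" using M by (simp add: L_def)
  \<comment> \<open>Chosen to give \<open>d * L \<le> e\<close>; the summand 1 keeps the denominator
    positive when \<open>M = 1\<close>, and the minimum keeps \<open>d\<close> below 1.\<close>
  define d where "d = min (1 / 2) (e / (L + 1))"
  have d: "0 < d" "d < 1" using e L by (auto simp: d_def)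
  have "d * L \<le> e / (L + 1) * L" using L by (intro mult_right_mono) (auto simp: d_def)
  also have "\<dots> \<le> e" using e L by (simp add: field_simps)
  finally have dL: "L - e \<le> (1 - d) * L" by (simp add: algebra_simps)
  show "frequently (\<lambda>b. ln (real M) / 2 - e \<le> ln (real (mult_fun F (idx b)))
      * ln (ln (real (N (idx b)))) / ln (real (N (idx b)))) G"
    unfolding frequently_def G
  proof (rule notI, elim exE)
    fix n0 assume *: "\<forall>b. n0 \<le> N (idx b) \<longrightarrow> \<not> ln (real M) / 2 - e \<le> ln (real (mult_fun F (idx b)))
      * ln (ln (real (N (idx b)))) / ln (real (N (idx b)))"
    obtain x where x: "x \<noteq> 0" "N x \<ge> n0" "(1 - d) * (ln (real M) / 2)
        \<le> ln (real (mult_fun F x)) * ln (ln (real (N x))) / ln (real (N x))"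
      using mult_fun_often_large[of F M d n0, OF F(1) M d] by auto
    obtain b where "idx b = x" using idx x by blast
    with * x(2) have "\<not> L - e \<le> ln (real (mult_fun F x)) * ln (ln (real (N x))) / ln (real (N x))"
      unfolding L_def by blast
    with x(3) dL show False unfolding L_def by linarith
  qed
qed

end

section \<open>The rational integers\<close>

interpretation nat_ufd: normed_ufd "id :: nat \<Rightarrow> nat" 1
proof
  fix n :: nat
  have "{x. normalize x = x \<and> x \<noteq> 0 \<and> id x \<le> n} = {1..n}" by auto
  then show "finite {x. normalize x = x \<and> x \<noteq> 0 \<and> id x \<le> n}"
    "card {x. normalize x = x \<and> x \<noteq> 0 \<and> id x \<le> n} \<le> 1 * n"
    "n \<le> 1 * card {x. normalize x = x \<and> x \<noteq> 0 \<and> id x \<le> n}" by simp_all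
qed simp_all

lemma tau_eq_num_tuples: "tau k a = nat_ufd.num_tuples k a"
  by (simp add: tau_def nat_ufd.num_tuples_def nat_ufd.tuples_def)

lemma tauE_eq_mult_fun: "tauE k n = nat_ufd.mult_fun (tau k) n"
  by (simp add: tauE_def nat_ufd.mult_fun_def)

lemma tau_2: "tau k 2 = k"
  by (simp add: tau_eq_num_tuples nat_ufd.num_tuples_prime)

text \<open>Strong induction with \<open>m = p * j\<close> for a prime \<open>p\<close>:
  \<open>tau k p = k\<close>, and \<open>2 + j \<le> p * j\<close> once \<open>j \<ge> 2\<close>.
  Equality at \<open>m = 2\<close> is the reason why squares of primes attain the maximal
  order.\<close>

lemma tau_square_le:
  assumes "k \<ge> 1" "m \<ge> 1"
  shows "(tau k m)\<^sup>2 \<le> k ^ m"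
  using assms(2)
proof (induction m rule: less_induct)
  case (less m)
  show ?case
  proof (cases "m = 1")
    case True
    then show ?thesis using assms nat_ufd.num_tuples_unit[of 1 k] by (simp add: tau_eq_num_tuples)
  next
    case False
    then obtain p where p: "prime p" "p dvd m" using prime_factor_nat by blast
    then obtain j where j: "m = p * j" by auto
    have p2: "p \<ge> 2" using p prime_ge_2_nat by blast
    have j1: "j \<ge> 1" using less.prems j by (cases j) auto
    have "tau k m \<le> tau k p * tau k j"
      unfolding tau_eq_num_tuples j using p2 j1 by (intro nat_ufd.num_tuples_mult_le) auto
    also have "tau k p = k" using p by (simp add: tau_eq_num_tuples nat_ufd.num_tuples_prime)
    finally have "(tau k m)\<^sup>2 \<le> (k * tau k j)\<^sup>2" by (intro power_mono) auto
    also have "\<dots> = k\<^sup>2 * (tau k j)\<^sup>2" by (simp add: power_mult_distrib)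
    also have "\<dots> \<le> k ^ m"
    \<comment> \<open>For \<open>j = 1\<close> and \<open>p = 2\<close> the inequality
      \<open>2 + j \<le> p * j\<close> fails, so here the exact value \<open>tau k 1 = 1\<close> is
      used.\<close>
    proof (cases "j = 1")
      case True
      then have "tau k j = 1" using nat_ufd.num_tuples_unit[of 1 k] by (simp add: tau_eq_num_tuples)
      then show ?thesis using True j p2 assms power_increasing[of 2 p k] by simp
    next
      case False
      have "j < m" using p2 j1 j by simp
      then have "k\<^sup>2 * (tau k j)\<^sup>2 \<le> k\<^sup>2 * k ^ j" using less.IH j1 by (intro mult_left_mono) auto
      also have "\<dots> = k ^ (2 + j)" by (simp only: power_add)
      also have "\<dots> \<le> k ^ m"
      proof (rule power_increasing)
        have "2 * j \<le> p * j" using p2 by (rule mult_right_mono) simp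
        then show "2 + j \<le> m" using False j1 j by linarith
      qed (use assms in auto)
      finally show ?thesis .
    qed
    finally show ?thesis .
  qed
qed

lemma tau_pos: "k \<ge> 1 \<Longrightarrow> m \<ge> 1 \<Longrightarrow> tau k m \<ge> 1"
  using nat_ufd.num_tuples_pos[of m k] by (simp add: tau_eq_num_tuples)

lemma tau_le_power: "m \<ge> 1 \<Longrightarrow> tau k m \<le> 1 * m ^ k"
  using nat_ufd.num_tuples_le_power[of m k] by (simp add: tau_eq_num_tuples)

section \<open>The Gaussian integers\<close>

text \<open>\<open>GI\<close> is a set of complex numbers, whereas divisibility theory is tied to
  type classes; \<open>gint\<close> inherits the operations of \<open>complex\<close> through the
  injection \<open>cplx\<close>.\<close>

typedef gint = GI morphisms cplx Abs_gint
  by (auto simp: GI_def intro!: exI[of _ 0])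

lemma GI_closed [simp]:
  "0 \<in> GI" "1 \<in> GI" "x \<in> GI \<Longrightarrow> y \<in> GI \<Longrightarrow> x + y \<in> GI"
  "x \<in> GI \<Longrightarrow> y \<in> GI \<Longrightarrow> x - y \<in> GI" "x \<in> GI \<Longrightarrow> - x \<in> GI"
  "x \<in> GI \<Longrightarrow> y \<in> GI \<Longrightarrow> x * y \<in> GI" "x \<in> GI \<Longrightarrow> cnj x \<in> GI"
  "Complex (of_int a) (of_int b) \<in> GI"
  by (auto simp: GI_def)

lemma cplx_GI [simp]: "cplx x \<in> GI"
  by (rule cplx)

lemma gint_eqI: "cplx x = cplx y \<Longrightarrow> x = y"
  by (simp add: cplx_inject)

instantiation gint :: comm_ring_1
begin

definition zero_gint where "0 = Abs_gint 0"
definition one_gint where "1 = Abs_gint 1"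
definition plus_gint where "x + y = Abs_gint (cplx x + cplx y)"
definition minus_gint where "x - y = Abs_gint (cplx x - cplx y)"
definition uminus_gint where "- x = Abs_gint (- cplx x)"
definition times_gint where "x * y = Abs_gint (cplx x * cplx y)"

lemma cplx_simps [simp]:
  "cplx 0 = 0" "cplx 1 = 1" "cplx (x + y) = cplx x + cplx y" "cplx (x - y) = cplx x - cplx y"
  "cplx (- x) = - cplx x" "cplx (x * y) = cplx x * cplx y"
  by (simp_all add: zero_gint_def one_gint_def plus_gint_def minus_gint_def uminus_gint_def
      times_gint_def Abs_gint_inverse)

instance
proof
  show "(0 :: gint) \<noteq> 1" by (metis cplx_simps(1,2) zero_neq_one)
qed (rule gint_eqI, simp add: algebra_simps)+

end

lemma cplx_eq_0_iff [simp]: "cplx x = 0 \<longleftrightarrow> x = 0"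
  by (metis cplx_simps(1) gint_eqI)

lemma cplx_power [simp]: "cplx (x ^ n) = cplx x ^ n"
  by (induction n) auto

lemma cplx_of_nat [simp]: "cplx (of_nat n) = of_nat n"
  by (induction n) auto

lemma cplx_prod_list: "cplx (prod_list xs) = prod_list (map cplx xs)"
  by (induction xs) auto

lemma cplx_cases:
  obtains a b :: int where "cplx x = Complex (of_int a) (of_int b)"
  using cplx_GI[of x] unfolding GI_def by (auto elim!: Ints_cases) (metis complex_surj)

section \<open>Division by rounding to the nearest lattice point\<close>

definition nearest_GI :: "complex \<Rightarrow> complex" where
  "nearest_GI z = Complex (of_int (round (Re z))) (of_int (round (Im z)))"

lemma nearest_GI_in_GI [simp]: "nearest_GI z \<in> GI"
  by (simp add: nearest_GI_def)

lemma nearest_GI_eq: "z \<in> GI \<Longrightarrow> nearest_GI z = z"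
  by (auto simp: nearest_GI_def GI_def complex_eq_iff elim!: Ints_cases)

text \<open>Each coordinate is off by at most 1/2, so the squared distance is at most 1/2. This is
  what makes the norm of a remainder smaller than that of the divisor.\<close>

lemma nearest_GI_dist: "(cmod (z - nearest_GI z))\<^sup>2 < 1"
proof -
  have "\<bar>Re z - of_int (round (Re z))\<bar> \<le> 1 / 2" "\<bar>Im z - of_int (round (Im z))\<bar> \<le> 1 / 2"
    using of_int_round_abs_le[of "Re z"] of_int_round_abs_le[of "Im z"]
    by (simp_all add: abs_minus_commute)
  then have "(Re z - of_int (round (Re z)))\<^sup>2 \<le> (1 / 2)\<^sup>2" "(Im z - of_int (round (Im z)))\<^sup>2 \<le> (1 / 2)\<^sup>2"
    by (simp_all only: abs_le_square_iff[symmetric] abs_of_nonneg[of "1 / 2 :: real"]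
        divide_nonneg_nonneg zero_le_one zero_le_numeral)
  then show ?thesis
    by (simp add: cmod_power2 nearest_GI_def power_divide)
qed

instantiation gint :: idom_modulo
begin

text \<open>Rounding returns the exact quotient whenever there is one, so the same operation serves
  as exact division and as Euclidean division.\<close>

definition divide_gint where "x div y = Abs_gint (nearest_GI (cplx x / cplx y))"
definition modulo_gint where "x mod y = x - (x div y) * (y :: gint)"

lemma cplx_divide: "cplx (x div y) = nearest_GI (cplx x / cplx y)"
  by (simp add: divide_gint_def Abs_gint_inverse)

instance
proof
  fix x y :: gint
  show "x * y \<noteq> 0" if "x \<noteq> 0" "y \<noteq> 0"
    using that by (simp flip: cplx_eq_0_iff)
  show "x * y div y = x" if "y \<noteq> 0"
    using that by (intro gint_eqI) (simp add: cplx_divide nearest_GI_eq)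
  show "x div 0 = 0"
    by (intro gint_eqI) (simp add: cplx_divide nearest_GI_eq)
  show "x div y * y + x mod y = x"
    by (simp add: modulo_gint_def)
qed

end

section \<open>Norm and units of the Gaussian integers\<close>

text \<open>On \<open>GI\<close> the squared modulus is already an integer; the floor only converts
  it to \<open>nat\<close>.\<close>

definition GI_norm :: "complex \<Rightarrow> nat" where
  "GI_norm z = nat \<lfloor>(cmod z)\<^sup>2\<rfloor>"

lemma of_nat_GI_norm:
  assumes "z \<in> GI"
  shows "real (GI_norm z) = (cmod z)\<^sup>2"
proof -
  obtain a b :: int where "Re z = of_int a" "Im z = of_int b"
    using assms by (auto simp: GI_def elim!: Ints_cases)
  then have "(cmod z)\<^sup>2 = of_int (a\<^sup>2 + b\<^sup>2)" by (simp add: cmod_power2)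
  then show ?thesis unfolding GI_norm_def by (metis floor_of_int of_int_0_le_iff of_nat_nat zero_le_power2)
qed

definition gint_norm :: "gint \<Rightarrow> nat" where
  "gint_norm x = GI_norm (cplx x)"

lemma of_nat_gint_norm: "real (gint_norm x) = (cmod (cplx x))\<^sup>2"
  by (simp add: gint_norm_def of_nat_GI_norm)

lemma gint_norm_mult: "gint_norm (x * y) = gint_norm x * gint_norm y"
proof -
  have "real (gint_norm (x * y)) = real (gint_norm x * gint_norm y)"
    by (simp add: of_nat_gint_norm norm_mult power_mult_distrib)
  then show ?thesis by (simp only: of_nat_eq_iff)
qed

lemma gint_norm_eq_0_iff: "gint_norm x = 0 \<longleftrightarrow> x = 0"
proof -
  have "gint_norm x = 0 \<longleftrightarrow> real (gint_norm x) = 0" by simp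
  then show ?thesis by (simp only: of_nat_gint_norm) simp
qed

lemma GI_norm_eq_1:
  assumes "z \<in> GI" "(cmod z)\<^sup>2 = 1"
  shows "z \<in> gunits"
proof -
  obtain a b :: int where ab: "Re z = of_int a" "Im z = of_int b"
    using assms by (auto simp: GI_def elim!: Ints_cases)
  then have "real_of_int (a\<^sup>2 + b\<^sup>2) = 1" using assms by (simp add: cmod_power2)
  then have *: "a\<^sup>2 + b\<^sup>2 = 1" by linarith
  then have "\<bar>a\<bar>\<^sup>2 \<le> 1\<^sup>2" "\<bar>b\<bar>\<^sup>2 \<le> 1\<^sup>2" using zero_le_power2[of a] zero_le_power2[of b] by (simp_all, linarith+)
  then have "\<bar>a\<bar> \<le> 1" "\<bar>b\<bar> \<le> 1" by (auto simp only: power2_le_imp_le)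
  then have "a \<in> {-1, 0, 1}" "b \<in> {-1, 0, 1}" by auto
  with * have "(a, b) \<in> {(1, 0), (-1, 0), (0, 1), (0, -1)}" by auto
  then show ?thesis using ab by (auto simp: gunits_def complex_eq_iff)
qed

lemma gunits_in_GI: "gunits \<subseteq> GI"
  by (auto simp: gunits_def GI_def)

lemma gint_norm_eq_1_iff: "gint_norm x = 1 \<longleftrightarrow> cplx x \<in> gunits"
proof -
  have "gint_norm x = 1 \<longleftrightarrow> real (gint_norm x) = 1" by simp
  also have "\<dots> \<longleftrightarrow> (cmod (cplx x))\<^sup>2 = 1" by (simp only: of_nat_gint_norm)
  also have "\<dots> \<longleftrightarrow> cplx x \<in> gunits"
    using GI_norm_eq_1[of "cplx x"] by (auto simp: gunits_def)
  finally show ?thesis .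
qed

lemma gint_is_unit_iff: "is_unit x \<longleftrightarrow> cplx x \<in> gunits" for x :: gint
proof
  assume "is_unit x"
  then obtain y where "1 = x * y" by auto
  then have "gint_norm x * gint_norm y = gint_norm 1" by (metis gint_norm_mult)
  also have "\<dots> = 1" by (simp only: gint_norm_eq_1_iff) (simp add: gunits_def)
  finally show "cplx x \<in> gunits" by (simp flip: gint_norm_eq_1_iff)
next
  assume u: "cplx x \<in> gunits"
  then have "cplx (x * Abs_gint (cnj (cplx x))) = 1"
    by (auto simp: Abs_gint_inverse gunits_def)
  then have "x * Abs_gint (cnj (cplx x)) = 1" by (metis cplx_simps(2) gint_eqI)
  then show "is_unit x" by (metis dvd_triv_left)
qed

section \<open>Canonical representatives and unique factorization\<close>

text \<open>The unit that carries the normalized associate of \<open>z\<close> to \<open>z\<close>.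
  The four half-open quadrants are the rotations of the one in \<open>gnormalized\<close>, and the
  value 0 at 0 is what \<open>unit_factor\<close> prescribes.\<close>

definition quadrant_unit :: "complex \<Rightarrow> complex" where
  "quadrant_unit z = (if z = 0 then 0 else if Re z > 0 \<and> Im z \<ge> 0 then 1
     else if Im z > 0 \<and> Re z \<le> 0 then \<i> else if Re z < 0 \<and> Im z \<le> 0 then -1 else -\<i>)"

lemma quadrant_unit_in_gunits: "z \<noteq> 0 \<Longrightarrow> quadrant_unit z \<in> gunits"
  by (simp add: quadrant_unit_def gunits_def)

lemma quadrant_unit_in_GI [simp]: "quadrant_unit z \<in> GI"
  using quadrant_unit_in_gunits[of z] gunits_in_GI by (cases "z = 0") (auto simp: quadrant_unit_def)

lemma quadrant_unit_mult: "u \<in> gunits \<Longrightarrow> quadrant_unit (u * z) = u * quadrant_unit z"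
proof (cases "z = 0")
  case False
  then have nz: "Re z \<noteq> 0 \<or> Im z \<noteq> 0" by (simp add: complex_eq_iff)
  assume "u \<in> gunits"
  then consider "u = 1" | "u = -1" | "u = \<i>" | "u = -\<i>" by (auto simp: gunits_def)
  then show ?thesis using False nz
    by cases (cases "Re z" "0 :: real" rule: linorder_cases;
        cases "Im z" "0 :: real" rule: linorder_cases; simp add: quadrant_unit_def)+
qed (simp add: quadrant_unit_def)

text \<open>A unit has modulus 1, so its conjugate is its inverse; this is why normalizing
  multiplies by the conjugate.\<close>

lemma quadrant_unit_cnj: "quadrant_unit z * (z * cnj (quadrant_unit z)) = z"
  by (auto simp: quadrant_unit_def)

instantiation gint :: normalization_euclidean_semiring
begin

definition euclidean_size_gint where "euclidean_size_gint = gint_norm"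
definition unit_factor_gint where "unit_factor x = Abs_gint (quadrant_unit (cplx x))"
definition normalize_gint where "normalize x = Abs_gint (cplx x * cnj (quadrant_unit (cplx x)))"

lemma cplx_unit_factor: "cplx (unit_factor x) = quadrant_unit (cplx x)"
  by (simp add: unit_factor_gint_def Abs_gint_inverse)

lemma cplx_normalize: "cplx (normalize x) = cplx x * cnj (quadrant_unit (cplx x))"
  by (simp add: normalize_gint_def Abs_gint_inverse)

instance
proof
  fix x y :: gint
  show "euclidean_size (0 :: gint) = 0"
    by (simp add: euclidean_size_gint_def gint_norm_eq_0_iff)
  show "euclidean_size (x mod y) < euclidean_size y" if "y \<noteq> 0"
  proof -
    have y: "cplx y \<noteq> 0" using that by simp
    let ?q = "cplx x / cplx y"
    have "cplx (x mod y) = (?q - nearest_GI ?q) * cplx y"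
      using y by (simp add: modulo_gint_def cplx_divide algebra_simps)
    then have "(cmod (cplx (x mod y)))\<^sup>2 = (cmod (?q - nearest_GI ?q))\<^sup>2 * (cmod (cplx y))\<^sup>2"
      by (simp only: norm_mult power_mult_distrib)
    also have "\<dots> < 1 * (cmod (cplx y))\<^sup>2"
      using y by (intro mult_strict_right_mono nearest_GI_dist) auto
    finally have "real (gint_norm (x mod y)) < real (gint_norm y)"
      by (simp add: of_nat_gint_norm)
    then show ?thesis by (simp add: euclidean_size_gint_def)
  qed
  show "euclidean_size x \<le> euclidean_size (x * y)" if "y \<noteq> 0"
    using that gint_norm_eq_0_iff[of y] by (simp add: euclidean_size_gint_def gint_norm_mult)
  show "unit_factor (0 :: gint) = 0"
    by (intro gint_eqI) (simp add: cplx_unit_factor quadrant_unit_def)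
  show "unit_factor x = x" if "is_unit x"
  proof (rule gint_eqI)
    have "cplx x \<in> gunits" using that by (simp add: gint_is_unit_iff)
    from quadrant_unit_mult[OF this, of 1] show "cplx (unit_factor x) = cplx x"
      by (simp add: cplx_unit_factor quadrant_unit_def)
  qed
  show "is_unit (unit_factor x)" if "x \<noteq> 0"
    using that by (simp add: gint_is_unit_iff cplx_unit_factor quadrant_unit_in_gunits)
  show "unit_factor (x * y) = x * unit_factor y" if "is_unit x"
    using that by (intro gint_eqI) (simp add: cplx_unit_factor gint_is_unit_iff quadrant_unit_mult)
  show "unit_factor x * normalize x = x"
    by (intro gint_eqI) (simp only: cplx_simps cplx_unit_factor cplx_normalize quadrant_unit_cnj)
  show "normalize (0 :: gint) = 0"
    by (intro gint_eqI) (simp add: cplx_normalize)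
qed

end

text \<open>The Euclidean algorithm supplies gcds and with them the factorial ring that
  \<open>normed_ufd\<close> asks for.\<close>

instantiation gint :: euclidean_ring_gcd
begin

definition gcd_gint :: "gint \<Rightarrow> gint \<Rightarrow> gint" where "gcd_gint = Euclidean_Algorithm.gcd"
definition lcm_gint :: "gint \<Rightarrow> gint \<Rightarrow> gint" where "lcm_gint = Euclidean_Algorithm.lcm"
definition Gcd_gint :: "gint set \<Rightarrow> gint" where "Gcd_gint = Euclidean_Algorithm.Gcd"
definition Lcm_gint :: "gint set \<Rightarrow> gint" where "Lcm_gint = Euclidean_Algorithm.Lcm"

instance
  by standard (simp_all add: gcd_gint_def lcm_gint_def Gcd_gint_def Lcm_gint_def)

end

lemma gint_normalize_eq_iff: "normalize x = x \<longleftrightarrow> quadrant_unit (cplx x) = 1 \<or> x = 0" for x :: gint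
proof
  assume *: "normalize x = x"
  have "quadrant_unit (cplx x) = 1" if "x \<noteq> 0"
  proof -
    have "cplx x * cnj (quadrant_unit (cplx x)) = cplx x * 1" by (metis * cplx_normalize mult_1_right)
    then have "cnj (quadrant_unit (cplx x)) = cnj 1" using that by simp
    then show ?thesis by (simp only: complex_cnj_cancel_iff)
  qed
  then show "quadrant_unit (cplx x) = 1 \<or> x = 0" by blast
next
  assume "quadrant_unit (cplx x) = 1 \<or> x = 0"
  then show "normalize x = x" by (auto intro!: gint_eqI simp: cplx_normalize)
qed

lemma gnormalized_cplx_iff: "gnormalized (cplx x) \<longleftrightarrow> normalize x = x \<and> x \<noteq> 0"
  unfolding gint_normalize_eq_iff gnormalized_def
  using cplx_eq_0_iff[of x] by (auto simp: quadrant_unit_def complex_eq_iff split: if_splits)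

section \<open>Counting lattice points in a quarter disc\<close>

lemma gnormalized_ball_eq:
  "cplx ` {x. normalize x = x \<and> x \<noteq> 0 \<and> gint_norm x \<le> n}
     = (\<lambda>(a, b). Complex (real a) (real b)) ` {(a, b). a \<noteq> 0 \<and> a\<^sup>2 + b\<^sup>2 \<le> n}"
proof (intro equalityI subsetI)
  fix z assume "z \<in> cplx ` {x. normalize x = x \<and> x \<noteq> 0 \<and> gint_norm x \<le> n}"
  then obtain x where x: "z = cplx x" "gnormalized (cplx x)" "gint_norm x \<le> n"
    by (auto simp: gnormalized_cplx_iff)
  obtain a b where ab: "cplx x = Complex (of_int a) (of_int b)" by (rule cplx_cases)
  have nonneg: "a > 0" "b \<ge> 0" using x ab by (auto simp: gnormalized_def)
  have "real (gint_norm x) = real ((nat a)\<^sup>2 + (nat b)\<^sup>2)"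
    using nonneg by (simp add: of_nat_gint_norm ab cmod_power2)
  then have "(nat a)\<^sup>2 + (nat b)\<^sup>2 \<le> n" using x by linarith
  then show "z \<in> (\<lambda>(a, b). Complex (real a) (real b)) ` {(a, b). a \<noteq> 0 \<and> a\<^sup>2 + b\<^sup>2 \<le> n}"
    using nonneg x ab by (intro image_eqI[of _ _ "(nat a, nat b)"]) auto
next
  fix z assume "z \<in> (\<lambda>(a, b). Complex (real a) (real b)) ` {(a, b). a \<noteq> 0 \<and> a\<^sup>2 + b\<^sup>2 \<le> n}"
  then obtain a b where ab: "z = Complex (real a) (real b)" "a \<noteq> 0" "a\<^sup>2 + b\<^sup>2 \<le> n" by auto
  define x where "x = Abs_gint z"
  have GI: "z \<in> GI" using ab by (simp add: GI_def)
  then have x: "cplx x = z" by (simp add: x_def Abs_gint_inverse)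
  have "gnormalized (cplx x)" using ab GI by (simp add: x gnormalized_def)
  moreover have "real (gint_norm x) = real (a\<^sup>2 + b\<^sup>2)"
    by (simp add: of_nat_gint_norm x ab cmod_power2)
  then have "gint_norm x \<le> n" using ab by linarith
  ultimately show "z \<in> cplx ` {x. normalize x = x \<and> x \<noteq> 0 \<and> gint_norm x \<le> n}"
    using x by (auto simp: gnormalized_cplx_iff)
qed

text \<open>\<open>S\<close> lies between the rectangles \<open>{1..s} \<times> {0..s}\<close> and
  \<open>{1..r} \<times> {0..r}\<close> with \<open>s\<close> and \<open>r\<close> the integer
  square roots of \<open>n div 2\<close> and \<open>n\<close>. The constant 4 is dictated by the
  inner one, where \<open>n + 1 \<le> 2 * (s + 1)^2 \<le> 4 * s * (s + 1) + 2\<close>.\<close>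

lemma lattice_points_quarter_disc:
  fixes n :: nat
  defines "S \<equiv> {(a, b). a \<noteq> 0 \<and> a\<^sup>2 + b\<^sup>2 \<le> n}"
  shows "finite S" "card S \<le> 4 * n" "n \<le> 4 * card S"
proof -
  define r where "r = floor_sqrt n"
  have r: "r\<^sup>2 \<le> n" by (simp add: r_def)
  have sub: "S \<subseteq> {1..r} \<times> {0..r}"
  proof
    fix z assume "z \<in> S"
    then obtain a b where z: "z = (a, b)" "a \<noteq> 0" "a\<^sup>2 + b\<^sup>2 \<le> n" by (auto simp: S_def)
    then have "a\<^sup>2 \<le> n" "b\<^sup>2 \<le> n" by linarith+
    then show "z \<in> {1..r} \<times> {0..r}" using z by (auto simp: r_def le_floor_sqrt_iff)
  qed
  then show fin: "finite S" by (rule finite_subset) auto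
  have "card S \<le> card ({1..r} \<times> {0..r})" by (intro card_mono sub) auto
  also have "\<dots> = r * (r + 1)" by (simp add: card_cartesian_product)
  also have "\<dots> \<le> 2 * r\<^sup>2" by (cases r) (auto simp: power2_eq_square)
  also have "\<dots> \<le> 4 * n" using r by simp
  finally show "card S \<le> 4 * n" .
  define s where "s = floor_sqrt (n div 2)"
  have s: "s\<^sup>2 \<le> n div 2" "n div 2 < (Suc s)\<^sup>2"
    using Suc_floor_sqrt_power2_gt by (auto simp: s_def)
  have "{1..s} \<times> {0..s} \<subseteq> S"
  proof
    fix z assume "z \<in> {1..s} \<times> {0..s}"
    then obtain a b where z: "z = (a, b)" "a \<noteq> 0" "a \<le> s" "b \<le> s" by (cases z) auto
    then have "a\<^sup>2 \<le> s\<^sup>2" "b\<^sup>2 \<le> s\<^sup>2" by (auto intro: power_mono)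
    moreover have "s\<^sup>2 + s\<^sup>2 \<le> n" using s by linarith
    ultimately have "a\<^sup>2 + b\<^sup>2 \<le> n" by linarith
    with z show "z \<in> S" by (auto simp: S_def)
  qed
  then have "card ({1..s} \<times> {0..s}) \<le> card S" using fin by (intro card_mono)
  then have card: "s * (s + 1) \<le> card S" by (simp add: card_cartesian_product)
  have "s = 0 \<or> n \<le> 4 * (s * (s + 1))"
  proof -
    have "n + 1 \<le> 2 * (s + 1)\<^sup>2" using s by simp
    moreover have "2 * (s + 1)\<^sup>2 \<le> 4 * (s * (s + 1)) + 2" by (simp add: power2_eq_square algebra_simps)
    ultimately show ?thesis by (cases s) (auto simp: power2_eq_square algebra_simps)
  qed
  \<comment> \<open>For \<open>s = 0\<close> the inner rectangle is empty; then
    \<open>n < 2\<close>, and the point \<open>(1, 0)\<close> suffices.\<close>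
  moreover have "n \<le> 4 * card S" if "s = 0"
  proof (cases "n = 0")
    case False
    then have "(1, 0) \<in> S" by (auto simp: S_def)
    then have "card S \<ge> 1" using fin by (metis One_nat_def Suc_leI card_gt_0_iff empty_iff)
    moreover have "n < 2" using s that by simp
    ultimately show ?thesis by linarith
  qed simp
  ultimately show "n \<le> 4 * card S" using card by linarith
qed

interpretation gauss_ufd: normed_ufd gint_norm 4
proof
  fix n :: nat
  let ?A = "{x. normalize x = x \<and> x \<noteq> 0 \<and> gint_norm x \<le> n}"
  let ?S = "{(a :: nat, b :: nat). a \<noteq> 0 \<and> a\<^sup>2 + b\<^sup>2 \<le> n}"
  have inj: "inj_on cplx ?A" by (auto intro!: inj_onI gint_eqI)
  have inj': "inj_on (\<lambda>(a, b). Complex (real a) (real b)) ?S" by (auto intro!: inj_onI)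
  note image = gnormalized_ball_eq[of n]
  have "finite (cplx ` ?A)" unfolding image by (intro finite_imageI lattice_points_quarter_disc)
  then show "finite ?A" using inj finite_image_iff by blast
  have card: "card ?A = card ?S"
    using card_image[OF inj] card_image[OF inj'] image by simp
  show "card ?A \<le> 4 * n" "n \<le> 4 * card ?A"
    unfolding card by (rule lattice_points_quarter_disc)+
qed (simp_all only: gint_norm_mult gint_norm_eq_0_iff gint_norm_eq_1_iff gint_is_unit_iff)

section \<open>Divisibility, primes and factorizations translated to \<open>gint\<close>\<close>

lemma gdvd_cplx_iff: "gdvd (cplx x) (cplx y) \<longleftrightarrow> x dvd y"
proof
  assume "gdvd (cplx x) (cplx y)"
  then obtain c where c: "c \<in> GI" "cplx y = cplx x * c" by (auto simp: gdvd_def)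
  then have "y = x * Abs_gint c" by (intro gint_eqI) (simp add: Abs_gint_inverse)
  then show "x dvd y" by simp
next
  assume "x dvd y"
  then obtain z where "y = x * z" by auto
  then show "gdvd (cplx x) (cplx y)" by (auto simp: gdvd_def intro!: bexI[of _ "cplx z"])
qed

lemma gassoc_cplx_iff: "gassoc (cplx x) (cplx y) \<longleftrightarrow> normalize x = normalize y"
proof
  assume "gassoc (cplx x) (cplx y)"
  then obtain u where u: "u \<in> gunits" "cplx x = u * cplx y" by (auto simp: gassoc_def)
  then have "u \<in> GI" using gunits_in_GI by blast
  then have u': "cplx (Abs_gint u) = u" by (simp add: Abs_gint_inverse)
  have "x = Abs_gint u * y" by (intro gint_eqI) (simp add: u' u)
  moreover have "is_unit (Abs_gint u)" by (simp add: gint_is_unit_iff u' u)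
  ultimately show "normalize x = normalize y" by (simp add: normalize_mult_unit_left)
next
  assume "normalize x = normalize y"
  then obtain u where "is_unit u" "x = u * y" by (rule associatedE1)
  then show "gassoc (cplx x) (cplx y)"
    by (auto simp: gassoc_def gint_is_unit_iff intro!: bexI[of _ "cplx u"])
qed

lemma GI_eq_range_cplx: "GI = range cplx"
  using type_definition.Rep_range[OF type_definition_gint] by simp

lemma gprime_cplx_iff: "gprime (cplx p) \<longleftrightarrow> prime_elem p"
proof -
  have "(\<forall>x\<in>GI. \<forall>y\<in>GI. gdvd (cplx p) (x * y) \<longrightarrow> gdvd (cplx p) x \<or> gdvd (cplx p) y)
    \<longleftrightarrow> (\<forall>x y. p dvd x * y \<longrightarrow> p dvd x \<or> p dvd y)"
    unfolding GI_eq_range_cplx by (simp flip: cplx_simps(6) add: gdvd_cplx_iff)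
  then show ?thesis by (simp add: gprime_def prime_elem_def gint_is_unit_iff)
qed

text \<open>The exponents \<open>e\<close> with \<open>p ^ e dvd x\<close> are exactly those up to
  the multiplicity, so the greatest one exists.\<close>

lemma gmult_cplx:
  assumes "prime p" "x \<noteq> 0"
  shows "gmult (cplx p) (cplx x) = multiplicity p x"
proof -
  have *: "gdvd (cplx p ^ e) (cplx x) \<longleftrightarrow> e \<le> multiplicity p x" for e
    using assms power_dvd_iff_le_multiplicity[of x p e]
    by (simp flip: cplx_power add: gdvd_cplx_iff not_prime_unit)
  show ?thesis unfolding gmult_def * by (rule Greatest_equality) auto
qed

lemma gauss_prime_factors:
  assumes "x \<noteq> 0"
  shows "{p. gprime p \<and> gnormalized p \<and> gdvd p (cplx x)} = cplx ` prime_factors x"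
proof (intro equalityI subsetI)
  fix z assume z: "z \<in> {p. gprime p \<and> gnormalized p \<and> gdvd p (cplx x)}"
  then have "z \<in> range cplx" by (auto simp: gprime_def simp flip: GI_eq_range_cplx)
  then obtain p where "z = cplx p" by auto
  with z assms show "z \<in> cplx ` prime_factors x"
    by (auto simp: gprime_cplx_iff gnormalized_cplx_iff gdvd_cplx_iff in_prime_factors_iff prime_def)
next
  fix z assume "z \<in> cplx ` prime_factors x"
  then show "z \<in> {p. gprime p \<and> gnormalized p \<and> gdvd p (cplx x)}"
    by (auto simp: gprime_cplx_iff gnormalized_cplx_iff gdvd_cplx_iff in_prime_factors_iff prime_def)
qed

lemma gauss_prod_eq_mult_fun:
  assumes "x \<noteq> 0"
  shows "(\<Prod>p\<in>{p. gprime p \<and> gnormalized p \<and> gdvd p (cplx x)}. F (gmult p (cplx x)))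
     = gauss_ufd.mult_fun F x"
proof -
  have "inj_on cplx (prime_factors x)" by (auto intro!: inj_onI gint_eqI)
  then have "(\<Prod>p\<in>cplx ` prime_factors x. F (gmult p (cplx x)))
      = (\<Prod>p\<in>prime_factors x. F (gmult (cplx p) (cplx x)))"
    by (simp add: prod.reindex)
  also have "\<dots> = (\<Prod>p\<in>prime_factors x. F (multiplicity p x))"
    by (intro prod.cong refl) (simp only: gmult_cplx[OF in_prime_factors_imp_prime assms])
  finally show ?thesis
    by (simp only: gauss_prime_factors[OF assms] gauss_ufd.mult_fun_def)
qed

lemma ttau_eq_num_tuples: "ttau k a = gauss_ufd.num_tuples k (of_nat a)"
proof -
  have "{ds. length ds = k \<and> (\<forall>d\<in>set ds. gnormalized d) \<and> gassoc (prod_list ds) (of_nat a)}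
     = map cplx ` gauss_ufd.tuples k (of_nat a)"
  proof (intro equalityI subsetI)
    fix ds assume ds: "ds \<in> {ds. length ds = k \<and> (\<forall>d\<in>set ds. gnormalized d) \<and> gassoc (prod_list ds) (of_nat a)}"
    define es where "es = map Abs_gint ds"
    have "ds = map cplx es" unfolding es_def map_map
      using ds by (intro map_idI[symmetric]) (auto simp: gnormalized_def Abs_gint_inverse)
    moreover from this ds have "es \<in> gauss_ufd.tuples k (of_nat a)"
      by (auto simp: gauss_ufd.tuples_def gnormalized_cplx_iff
          simp flip: cplx_prod_list gassoc_cplx_iff)
    ultimately show "ds \<in> map cplx ` gauss_ufd.tuples k (of_nat a)" by blast
  next
    fix ds assume "ds \<in> map cplx ` gauss_ufd.tuples k (of_nat a)"
    then show "ds \<in> {ds. length ds = k \<and> (\<forall>d\<in>set ds. gnormalized d) \<and> gassoc (prod_list ds) (of_nat a)}"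
      by (auto simp: gauss_ufd.tuples_def gnormalized_cplx_iff
          simp flip: cplx_prod_list gassoc_cplx_iff)
  qed
  moreover have "inj (map cplx)" by (auto intro!: injI gint_eqI)
  ultimately show ?thesis
    unfolding ttau_def gauss_ufd.num_tuples_def by (metis card_image inj_on_subset subset_UNIV)
qed

section \<open>Values and bounds of \<open>ttau\<close>\<close>

lemma gint_norm_of_nat: "gint_norm (of_nat a) = a\<^sup>2"
proof -
  have "real (gint_norm (of_nat a)) = real (a\<^sup>2)" by (simp add: of_nat_gint_norm)
  then show ?thesis by (simp only: of_nat_eq_iff)
qed

lemma gint_of_nat_eq_0_iff [simp]: "(of_nat a :: gint) = 0 \<longleftrightarrow> a = 0"
  by (simp flip: gint_norm_eq_0_iff add: gint_norm_of_nat)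

text \<open>The ramification \<open>2 = -\<i> (1 + \<i>)\<^sup>2\<close> is what produces the constant.\<close>

lemma ttau_2: "ttau k 2 = (k + 1) choose 2"
proof -
  define p where "p = Abs_gint (Complex 1 1)"
  have p: "cplx p = Complex 1 1"
    using GI_closed(8)[of 1 1] by (simp add: p_def Abs_gint_inverse)
  have "real (gint_norm p) = 2" by (simp add: of_nat_gint_norm p cmod_power2)
  then have "gint_norm p = 2" by linarith
  then have "prime_elem p" by (intro gauss_ufd.prime_norm_imp_prime_elem) simp
  moreover have "gnormalized (cplx p)" by (simp add: gnormalized_def p[symmetric]) (simp add: p)
  ultimately have "prime p" by (simp add: prime_def gnormalized_cplx_iff)
  have "cplx (of_nat 2) = - \<i> * cplx (p ^ 2)"
    by (simp add: p power2_eq_square complex_eq_iff del: of_nat_numeral)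
  then have "gassoc (cplx (of_nat 2)) (cplx (p ^ 2))"
    unfolding gassoc_def by (intro bexI[of _ "- \<i>"]) (simp_all add: gunits_def)
  then have "normalize (of_nat 2) = normalize (p ^ 2)" by (simp only: gassoc_cplx_iff)
  then have "ttau k 2 = gauss_ufd.num_tuples k (p ^ 2)"
    unfolding ttau_eq_num_tuples by (rule gauss_ufd.num_tuples_cong)
  then show ?thesis using gauss_ufd.num_tuples_prime_square[OF \<open>prime p\<close>] by simp
qed

lemma ttau_mult_le: "m \<ge> 1 \<Longrightarrow> n \<ge> 1 \<Longrightarrow> ttau k (m * n) \<le> ttau k m * ttau k n"
  unfolding ttau_eq_num_tuples of_nat_mult by (intro gauss_ufd.num_tuples_mult_le) auto

lemma ttau_1: "ttau k 1 = 1"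
  using gauss_ufd.num_tuples_unit[of 1 k] by (simp add: ttau_eq_num_tuples)

text \<open>With \<open>B = ttau k 2\<close> the prime 2 gives equality, and for an odd prime
  \<open>ttau k p \<le> k^2\<close>, so that \<open>k^4 \<le> B^3\<close> suffices. Composite
  \<open>m\<close> follow from submultiplicativity as for \<open>tau\<close>.\<close>

lemma ttau_square_le:
  assumes "k \<ge> 1" "m \<ge> 1"
  shows "(ttau k m)\<^sup>2 \<le> ((k + 1) choose 2) ^ m"
  using assms(2)
proof (induction m rule: less_induct)
  case (less m)
  define B where "B = (k + 1) choose 2"
  have "2 * B = k * (k + 1)" unfolding B_def choose_two by simp
  then have "4 * B\<^sup>2 = k\<^sup>2 * (k + 1)\<^sup>2" by (metis power_mult_distrib power2_eq_square numeral_Bit0 mult_2)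
  \<comment> \<open>This is \<open>(k - 1)^2 \<ge> 0\<close>, read over \<open>int\<close> because
    subtraction truncates on \<open>nat\<close>.\<close>
  moreover have "4 * k \<le> (k + 1)\<^sup>2"
    using zero_le_power2[of "int k - 1"] by (simp add: power2_eq_square algebra_simps flip: of_nat_mult)
  ultimately have "k\<^sup>2 * (4 * k) \<le> 4 * B\<^sup>2" by simp
  then have kB: "k ^ 3 \<le> B ^ 2" by (simp add: power2_eq_square power3_eq_cube)
  have "k \<le> B" using \<open>2 * B = k * (k + 1)\<close> assms by (cases k) auto
  then have "k ^ 3 * k \<le> B\<^sup>2 * B" by (intro mult_mono kB) auto
  then have k4: "k ^ 4 \<le> B ^ 3" by (simp add: power_numeral_reduce mult_ac)
  have B: "B \<ge> 1" using \<open>k \<le> B\<close> assms by linarith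
  show ?case
  proof (cases "m = 1")
    case True
    then show ?thesis using B ttau_1[of k] by (simp add: B_def)
  next
    case False
    then obtain p where p: "prime p" "p dvd m" using prime_factor_nat by blast
    then obtain j where j: "m = p * j" by auto
    have p2: "p \<ge> 2" using p prime_ge_2_nat by blast
    have j1: "j \<ge> 1" using less.prems j by (cases j) auto
    have jm: "j < m" using p2 j1 j by simp
    have "ttau k m \<le> ttau k p * ttau k j"
      unfolding j using p2 j1 by (intro ttau_mult_le) auto
    then have "(ttau k m)\<^sup>2 \<le> (ttau k p * ttau k j)\<^sup>2" by (intro power_mono) auto
    also have "\<dots> = (ttau k p)\<^sup>2 * (ttau k j)\<^sup>2" by (simp add: power_mult_distrib)
    also have "\<dots> \<le> B ^ m"
    proof -
      \<comment> \<open>Exponent 2 for \<open>p = 2\<close> and 3 for odd \<open>p\<close>;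
        \<open>r \<le> p\<close> in both cases, so a single inductive step covers them.\<close>
      define r where "r = min p 3"
      have tp: "(ttau k p)\<^sup>2 \<le> B ^ r"
      proof (cases "p = 2")
        case True
        then show ?thesis by (simp add: ttau_2 B_def r_def)
      next
        case False
        then have "r = 3" using p2 by (simp add: r_def)
        have "ttau k p \<le> k\<^sup>2"
          unfolding ttau_eq_num_tuples
          by (rule gauss_ufd.num_tuples_norm_prime_square[OF p(1)]) (simp add: gint_norm_of_nat)
        then have "(ttau k p)\<^sup>2 \<le> (k\<^sup>2)\<^sup>2" by (intro power_mono) auto
        also have "\<dots> = k ^ 4" by simp
        finally show ?thesis using k4 \<open>r = 3\<close> by simp
      qed
      show ?thesis
      proof (cases "j = 1")
        case True
        have "(ttau k p)\<^sup>2 * (ttau k j)\<^sup>2 \<le> B ^ r" using tp True by (simp add: ttau_1[simplified])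
        also have "\<dots> \<le> B ^ m" using B True j by (intro power_increasing) (auto simp: r_def)
        finally show ?thesis .
      next
        case False
        have "(ttau k p)\<^sup>2 * (ttau k j)\<^sup>2 \<le> B ^ r * B ^ j"
          using tp less.IH[OF jm j1] by (intro mult_mono) (auto simp: B_def)
        also have "\<dots> = B ^ (r + j)" by (simp add: power_add)
        also have "\<dots> \<le> B ^ m"
        proof (rule power_increasing)
          have "r * j \<le> p * j" by (intro mult_right_mono) (auto simp: r_def)
          \<comment> \<open>True because \<open>r\<close> and \<open>j\<close> are both at least 2;
            \<open>j = 1\<close> is the separate case above.\<close>
          moreover have "r + j \<le> r * j"
          proof -
            have "r = 2 \<or> r = 3" using p2 by (auto simp: r_def min_def)
            then show ?thesis using False j1 by auto
          qed
          ultimately show "r + j \<le> m" using j by linarith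
        qed (rule B)
        finally show ?thesis .
      qed
    qed
    finally show ?thesis by (simp add: B_def)
  qed
qed

lemma ttau_pos: "k \<ge> 1 \<Longrightarrow> m \<ge> 1 \<Longrightarrow> ttau k m \<ge> 1"
  using gauss_ufd.num_tuples_pos[of "of_nat m" k] by (simp add: ttau_eq_num_tuples)

text \<open>The natural number \<open>m\<close> has norm \<open>m^2\<close> in the Gaussian
  integers, and 4 is the counting constant of \<open>gauss_ufd\<close>.\<close>

lemma ttau_le_power: "m \<ge> 1 \<Longrightarrow> ttau k m \<le> 4 ^ k * m ^ (2 * k)"
  using gauss_ufd.num_tuples_le_power[of "of_nat m" k]
  by (simp add: ttau_eq_num_tuples gint_norm_of_nat power_mult_distrib power_mult)

section \<open>Gaussian integers as pairs of integers, and the upper limits\<close>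

definition gint_of :: "int \<times> int \<Rightarrow> gint" where
  "gint_of ab = Abs_gint (gauss ab)"

lemma cplx_gint_of [simp]: "cplx (gint_of ab) = gauss ab"
  by (simp add: gint_of_def Abs_gint_inverse gauss_def)

lemma gint_norm_gint_of: "int (gint_norm (gint_of ab)) = gnorm ab"
proof -
  have "real_of_int (int (gint_norm (gint_of ab))) = real_of_int (gnorm ab)"
    by (simp add: of_nat_gint_norm gauss_def gnorm_def cmod_power2)
  then show ?thesis by (simp only: of_int_eq_iff)
qed

lemma gint_of_surj: "\<exists>ab. gint_of ab = x"
proof -
  obtain a b where "cplx x = Complex (of_int a) (of_int b)" by (rule cplx_cases)
  then have "gint_of (a, b) = x" by (intro gint_eqI) (simp add: gauss_def)
  then show ?thesis by blast
qed

text \<open>Brings the filter on pairs into the form demanded of \<open>G\<close> in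
  \<open>Limsup_mult_fun\<close>; \<open>nat m\<close> takes care of negative thresholds.\<close>

lemma eventually_gnorm_iff:
  "eventually P (filtercomap gnorm at_top) \<longleftrightarrow> (\<exists>n0. \<forall>ab. gint_norm (gint_of ab) \<ge> n0 \<longrightarrow> P ab)"
proof
  assume "eventually P (filtercomap gnorm at_top)"
  then obtain m where m: "\<And>ab. gnorm ab \<ge> m \<Longrightarrow> P ab"
    unfolding eventually_filtercomap_at_top_linorder by blast
  show "\<exists>n0. \<forall>ab. gint_norm (gint_of ab) \<ge> n0 \<longrightarrow> P ab"
    by (rule exI[of _ "nat m"]) (auto intro!: m simp flip: gint_norm_gint_of)
next
  assume "\<exists>n0. \<forall>ab. gint_norm (gint_of ab) \<ge> n0 \<longrightarrow> P ab"
  then obtain n0 where "\<And>ab. gint_norm (gint_of ab) \<ge> n0 \<Longrightarrow> P ab" by blast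
  then show "eventually P (filtercomap gnorm at_top)"
    unfolding eventually_filtercomap_at_top_linorder
    by (intro exI[of _ "int n0"]) (auto simp flip: gint_norm_gint_of)
qed

lemma Limsup_gauss:
  assumes "F 2 = M" "\<And>m. m \<ge> 1 \<Longrightarrow> F m \<ge> 1" "\<And>m. m \<ge> 1 \<Longrightarrow> F m ^ 2 \<le> M ^ m"
    "\<And>m. m \<ge> 1 \<Longrightarrow> F m \<le> D * m ^ c"
  shows "Limsup (filtercomap gnorm at_top) (\<lambda>ab. ereal (ln (real
      (\<Prod>p\<in>{p. gprime p \<and> gnormalized p \<and> gdvd p (gauss ab)}. F (gmult p (gauss ab))))
      * ln (ln (real_of_int (gnorm ab))) / ln (real_of_int (gnorm ab)))) = ereal (ln (real M) / 2)"
proof -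
  have norm: "real_of_int (gnorm ab) = real (gint_norm (gint_of ab))" for ab
    by (simp flip: gint_norm_gint_of)
  have "ln (real (\<Prod>p\<in>{p. gprime p \<and> gnormalized p \<and> gdvd p (gauss ab)}. F (gmult p (gauss ab))))
      * ln (ln (real_of_int (gnorm ab))) / ln (real_of_int (gnorm ab))
    = ln (real (gauss_ufd.mult_fun F (gint_of ab))) * ln (ln (real (gint_norm (gint_of ab))))
      / ln (real (gint_norm (gint_of ab)))" for ab
  proof (cases "gint_of ab = 0")
    \<comment> \<open>At 0 both denominators are \<open>ln 0 = 0\<close>, so both quotients are 0
      whatever the products are.\<close>
    case True
    have "gint_norm 0 = 0" by (simp add: gint_norm_eq_0_iff)
    then show ?thesis by (simp only: True norm) simp
  next
    case False
    then show ?thesis using gauss_prod_eq_mult_fun[of "gint_of ab" F] by (simp add: norm)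
  qed
  moreover have "Limsup (filtercomap gnorm at_top) (\<lambda>ab. ereal (ln (real (gauss_ufd.mult_fun F (gint_of ab)))
      * ln (ln (real (gint_norm (gint_of ab)))) / ln (real (gint_norm (gint_of ab))))) = ereal (ln (real M) / 2)"
    by (rule gauss_ufd.Limsup_mult_fun[OF assms gint_of_surj eventually_gnorm_iff])
  ultimately show ?thesis by simp
qed

lemma limsup_nat:
  assumes "F 2 = M" "\<And>m. m \<ge> 1 \<Longrightarrow> F m \<ge> 1" "\<And>m. m \<ge> 1 \<Longrightarrow> F m ^ 2 \<le> M ^ m"
    "\<And>m. m \<ge> 1 \<Longrightarrow> F m \<le> D * m ^ c"
  shows "limsup (\<lambda>n. ereal (ln (real (nat_ufd.mult_fun F n)) * ln (ln (real n)) / ln (real n)))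
     = ereal (ln (real M) / 2)"
  using nat_ufd.Limsup_mult_fun[OF assms, where idx = "\<lambda>n. n" and G = sequentially]
  by (simp add: eventually_sequentially)

lemma tauEs_eq_mult_fun: "tauEs k n = nat_ufd.mult_fun (ttau k) n"
  by (simp add: tauEs_def nat_ufd.mult_fun_def)

theorem theorem2:
  fixes k :: nat
  assumes "k \<ge> 2"
  shows "limsup (\<lambda>n. ereal (ln (real (tauE k n)) * ln (ln (real n)) / ln (real n)))
           = ereal (ln (real k) / 2)
       \<and> limsup (\<lambda>n. ereal (ln (real (tauEs k n)) * ln (ln (real n)) / ln (real n)))
           = ereal (ln (real ((k + 1) choose 2)) / 2)
       \<and> Limsup (filtercomap gnorm at_top)
           (\<lambda>ab. ereal (ln (real (gtauE k (gauss ab))) * ln (ln (real_of_int (gnorm ab)))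
                         / ln (real_of_int (gnorm ab))))
           = ereal (ln (real k) / 2)
       \<and> Limsup (filtercomap gnorm at_top)
           (\<lambda>ab. ereal (ln (real (gtauEs k (gauss ab))) * ln (ln (real_of_int (gnorm ab)))
                         / ln (real_of_int (gnorm ab))))
           = ereal (ln (real ((k + 1) choose 2)) / 2)"
proof -
  have k: "k \<ge> 1" using assms by simp
  \<comment> \<open>The four facts match the hypotheses on \<open>F\<close> in order: value at 2,
    positivity, bound by \<open>M ^ (m / 2)\<close>, polynomial growth.\<close>
  note tau = tau_2[of k] tau_pos[OF k] tau_square_le[OF k] tau_le_power[of _ k]
  note ttau = ttau_2[of k] ttau_pos[OF k] ttau_square_le[OF k] ttau_le_power[of _ k]
  show ?thesis
    unfolding tauE_eq_mult_fun tauEs_eq_mult_fun gtauE_def gtauEs_def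
    by (intro conjI limsup_nat[OF tau] limsup_nat[OF ttau] Limsup_gauss[OF tau] Limsup_gauss[OF ttau])
qed

end
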